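(* Let $n\in\{2,3\}$, and let $[V^1_{h,1}]^n$, $V^{\mathbf c}_h$, $V^{\mathbf d}_h$, $V^{\mathrm D}_h$ be the (finite-dimensional) conforming finite element spaces described in the context, with $$n_1=\dim [V^1_{h,1}]^n,\quad n_{\mathbf c}=\dim V^{\mathbf c}_h,\quad n_{\mathbf d}=\dim V^{\mathbf d}_h,\quad n_{\mathrm D}=\dim V^{\mathrm D}_h .$$ Put $Z_h=[V^1_{h,1}]^n\times V^{\mathbf c}_h\times V^{\mathbf d}_h\times V^{\mathrm D}_h$. Let $u=(\boldsymbol U,\boldsymbol K,\boldsymbol P,p)$ be a regular solution of the four-field weak problem of incompressible nonlinear elasticity and let $u_h^i=(\boldsymbol U_h^i,\boldsymbol K_h^i,\boldsymbol P_h^i,p_h^i)\in \bar Z_h$ be a given Newton iterate (all as defined in the context). Suppose that at least one of the following inequalities holds: (i) $n_1>n_{\mathbf d}$; (ii) $n_{\mathrm D}>n_{\mathbf c}$; (iii) $n_1>n_{\mathbf c}+n_{\mathrm D}$; (iv) $n_{\mathrm D}>n_1$. Then: (a) the inf-sup condition does not hold, i.e. there is no $\alpha>0$ such that $$\inf_{0\ne y_h\in Z_h}\ \sup_{0\ne z_h\in Z_h}\frac{b(z_h,y_h;u)}{\|z_h\|_Z\,\|y_h\|_Z}\ \ge\ \alpha ;$$ (b) the discrete Newton iteration does not admit a unique solution, i.e. the linear problem of finding $z_h\in Z_h$ such that $$b(z_h,y_h;u_h^i)=-\langle H(u_h^i),y_h\rangle\qquad\text{for all } y_h\in Z_h$$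 does not have exactly one solution.
   Context: Domain and function spaces. $\mathcal B\subset\mathbb R^n$, $n\in\{2,3\}$, is the reference configuration of an elastic body, with boundary $\partial\mathcal B=\Gamma_1\cup\Gamma_2$. $[H^1(\mathcal B)]^n$ is the space of vector fields with $H^1$ components, and $[H^1_1(\mathcal B)]^n$ is the subspace of those vanishing on $\Gamma_1$. $H^{\mathbf c}(\mathcal B)$ (resp. $H^{\mathbf d}(\mathcal B)$) is the space of second-order tensor fields with $L^2$ components whose row-wise curl (resp. row-wise divergence) is of class $L^2$. $\langle\!\langle\cdot,\cdot\rangle\!\rangle$ denotes the $L^2(\mathcal B)$ inner product of functions, vector fields, or tensor fields (componentwise). Let $$\bar Z=[H^1(\mathcal B)]^n\times H^{\mathbf c}(\mathcal B)\times H^{\mathbf d}(\mathcal B)\times L^2(\mathcal B),\qquad Z=[H^1_1(\mathcal B)]^n\times H^{\mathbf c}(\mathcal B)\times H^{\mathbf d}(\mathcal B)\times L^2(\mathcal B),$$ and let $\|\cdot\|_Z$ be the (product) norm of $Z$. Finite element spaces. $[V^1_h]^n\subset[H^1(\mathcal B)]^n$, $V^{\mathbf c}_h\subset H^{\mathbf c}(\mathcal B)$, $V^{\mathbf d}_h\subset H^{\mathbf d}(\mathcal B)$, $V^{\mathrm D}_h\subset L^2(\mathcal B)$ are finite-dimensional subspaces, and $[V^1_{h,1}]^n=[V^1_h]^n\cap[H^1_1(\mathcal B)]^n$. Put $\bar Z_h=[V^1_h]^n\times V^{\mathbf c}_h\times V^{\mathbf d}_h\times V^{\mathrm D}_h$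 and $Z_h=[V^1_{h,1}]^n\times V^{\mathbf c}_h\times V^{\mathbf d}_h\times V^{\mathrm D}_h$. Constitutive data. $\mathbb P$ is a given (differentiable) tensor-valued function of the displacement gradient $\boldsymbol K$; $\mathsf A(\boldsymbol K)$ is the elasticity tensor (the derivative of $\mathbb P$ at $\boldsymbol K$), acting by $(\mathsf A(\boldsymbol K):\boldsymbol M)^{IJ}=A^{IJRS}M^{RS}$ (summation over repeated indices). $\boldsymbol I$ is the identity tensor. $\boldsymbol B$ is a given body force, $\overline{\boldsymbol U}$ a given boundary displacement, and $\overline{\boldsymbol T}$ a given traction vector field on $\Gamma_2$. Nonlinear weak problem. For $u=(\boldsymbol U,\boldsymbol K,\boldsymbol P,p)\in\bar Z$ and $y=(\boldsymbol\Upsilon,\boldsymbol\lambda,\boldsymbol\pi,q)\in Z$ set $$\begin{aligned}\langle H(u),y\rangle={}&\langle\!\langle\boldsymbol P,\mathbf{grad}\,\boldsymbol\Upsilon\rangle\!\rangle+\langle\!\langle\mathbf{grad}\,\boldsymbol U,\boldsymbol\lambda\rangle\!\rangle-\langle\!\langle\boldsymbol K,\boldsymbol\lambda\rangle\!\rangle+\langle\!\langle\mathbb P(\boldsymbol K),\boldsymbol\pi\rangle\!\rangle-\langle\!\langle\boldsymbol P,\boldsymbol\pi\rangle\!\rangle\\&-\langle\!\langle p(\boldsymbol I+\boldsymbol K)^{-T},\boldsymbol\pi\rangle\!\rangle+\langle\!\langle\det(\boldsymbol I+\boldsymbol K),q\rangle\!\rangle-\langle\!\langle\boldsymbol B,\boldsymbol\Upsilon\rangle\!\rangle-\int_{\Gamma_2}\overline{\boldsymbol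 T}\cdot\boldsymbol\Upsilon\,dA-\langle\!\langle1,q\rangle\!\rangle.\end{aligned}$$ The four-field weak problem is: find $u\in\bar Z$ with $\boldsymbol U=\overline{\boldsymbol U}$ on $\Gamma_1$ and $\langle H(u),y\rangle=0$ for all $y\in Z$. A solution $u$ is called regular if the derivative of $H$ at $u$ (given by the bilinear form $b(\cdot,\cdot;u)$ on $Z\times Z$ below) is nonsingular. Linearization. For $w=(\boldsymbol U,\boldsymbol K,\boldsymbol P,p)\in\bar Z$, $z=(\boldsymbol V,\boldsymbol M,\boldsymbol Q,r)\in Z$ and $y=(\boldsymbol\Upsilon,\boldsymbol\lambda,\boldsymbol\pi,q)\in Z$, $$\begin{aligned}b(z,y;w)={}&\langle\!\langle\boldsymbol Q,\mathbf{grad}\,\boldsymbol\Upsilon\rangle\!\rangle+\langle\!\langle\mathbf{grad}\,\boldsymbol V,\boldsymbol\lambda\rangle\!\rangle-\langle\!\langle\boldsymbol M,\boldsymbol\lambda\rangle\!\rangle+\langle\!\langle\mathsf A(\boldsymbol K):\boldsymbol M,\boldsymbol\pi\rangle\!\rangle-\langle\!\langle\boldsymbol Q,\boldsymbol\pi\rangle\!\rangle\\&+\langle\!\langle p(\boldsymbol I+\boldsymbol K)^{-T}\boldsymbol M^{T}(\boldsymbol I+\boldsymbol K)^{-T},\boldsymbol\pi\rangle\!\rangle-\langle\!\langle r(\boldsymbol I+\boldsymbol K)^{-T},\boldsymbol\pi\rangle\!\rangle\\&+\langle\!\langle\det(\boldsymbol I+\boldsymbol K)\,\mathrm{tr}[(\boldsymbol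 I+\boldsymbol K)^{-1}\boldsymbol M],q\rangle\!\rangle.\end{aligned}$$ The $i$-th discrete Newton iteration, given $u_h^i\in\bar Z_h$, seeks $z_h\in Z_h$ with $b(z_h,y_h;u_h^i)=-\langle H(u_h^i),y_h\rangle$ for all $y_h\in Z_h$, and sets $u_h^{i+1}=u_h^i+z_h$. It is understood that $u$ and $u_h^i$ are such that $\boldsymbol I+\boldsymbol K$ and $\boldsymbol I+\boldsymbol K_h^i$ are invertible almost everywhere and that all integrals above are well defined and finite for all arguments in $Z_h$. *)

theory Defs
  imports "HOL-Analysis.Analysis"
begin

text \<open>
  Fields are total functions on \<open>\<real>\<^sup>n\<close> of which only the values on the open set \<open>B\<close> matter. Elements
  of the function spaces are representatives of classes modulo equality almost everywhere on \<open>B\<close>,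
  so "zero", "equal", "dimension" and "unique" are all meant modulo \<^term>\<open>lebesgue_on B\<close>-null sets.
  Matrices carry the Frobenius norm and the componentwise inner product of \<^typ>\<open>real^'n^'n\<close>;
  in a tensor \<open>T\<close>, \<open>T $ I $ J\<close> is the component in row \<open>I\<close> and column \<open>J\<close>.
\<close>

type_synonym 'n region = "(real^'n) set"
type_synonym 'n tensor_map = "real^'n^'n \<Rightarrow> real^'n^'n"
type_synonym 'n sfield = "real^'n \<Rightarrow> real"
type_synonym 'n vfield = "real^'n \<Rightarrow> real^'n"
type_synonym 'n tfield = "real^'n \<Rightarrow> real^'n^'n"
type_synonym 'n fields = "'n vfield \<times> 'n tfield \<times> 'n tfield \<times> 'n sfield"


subsection \<open>Square-integrable fields and their pairing\<close>

definition sq_int :: "'a measure \<Rightarrow> ('a \<Rightarrow> 'b::euclidean_space) \<Rightarrow> bool" where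
  "sq_int M f \<longleftrightarrow> f \<in> borel_measurable M \<and> integrable M (\<lambda>x. (norm (f x))\<^sup>2)"

definition l2_norm :: "'a measure \<Rightarrow> ('a \<Rightarrow> 'b::euclidean_space) \<Rightarrow> real" where
  "l2_norm M f = sqrt (LINT x|M. (norm (f x))\<^sup>2)"

definition L2 :: "'n region \<Rightarrow> (real^'n \<Rightarrow> 'b::euclidean_space) set" where
  "L2 B = {f. sq_int (lebesgue_on B) f}"

definition ip :: "'n region \<Rightarrow> (real^'n \<Rightarrow> 'b::euclidean_space) \<Rightarrow> (real^'n \<Rightarrow> 'b) \<Rightarrow> real" where
  "ip B f g = (LINT x|lebesgue_on B. f x \<bullet> g x)"

text \<open>The pairing \<^const>\<open>ip\<close> is also applied to nonlinear expressions that need not be of class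
  \<open>L\<^sup>2\<close>; the next predicate says that the integral exists and is finite.\<close>

definition ip_ok :: "'n region \<Rightarrow> (real^'n \<Rightarrow> 'b::euclidean_space) \<Rightarrow> (real^'n \<Rightarrow> 'b) \<Rightarrow> bool" where
  "ip_ok B f g \<longleftrightarrow> integrable (lebesgue_on B) (\<lambda>x. f x \<bullet> g x)"

definition null_on :: "'n region \<Rightarrow> (real^'n \<Rightarrow> 'b::euclidean_space) \<Rightarrow> bool" where
  "null_on B f \<longleftrightarrow> (AE x in lebesgue_on B. f x = 0)"


subsection \<open>Test functions and weak derivatives\<close>

definition pd :: "'n \<Rightarrow> 'n::finite sfield \<Rightarrow> 'n sfield" where
  "pd j f x = frechet_derivative f (at x) (axis j 1)"

primrec Ck :: "nat \<Rightarrow> 'n::finite sfield \<Rightarrow> bool" where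
  "Ck 0 f \<longleftrightarrow> continuous_on UNIV f"
| "Ck (Suc k) f \<longleftrightarrow> (\<forall>x. f differentiable (at x)) \<and> (\<forall>j. Ck k (pd j f))"

definition smooth :: "'n::finite sfield \<Rightarrow> bool" where
  "smooth f \<longleftrightarrow> (\<forall>k. Ck k f)"

definition test_fun :: "'n region \<Rightarrow> 'n::finite sfield \<Rightarrow> bool" where
  "test_fun B \<phi> \<longleftrightarrow> smooth \<phi> \<and> compact (closure {x. \<phi> x \<noteq> 0}) \<and> closure {x. \<phi> x \<noteq> 0} \<subseteq> B"

definition weak_pd :: "'n region \<Rightarrow> 'n \<Rightarrow> 'n::finite sfield \<Rightarrow> 'n sfield \<Rightarrow> bool" where
  "weak_pd B j v g \<longleftrightarrow> (\<forall>\<phi>. test_fun B \<phi> \<longrightarrow> ip B g \<phi> = - ip B v (pd j \<phi>))"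

definition weak_div :: "'n region \<Rightarrow> 'n::finite tfield \<Rightarrow> 'n vfield \<Rightarrow> bool" where
  "weak_div B T d \<longleftrightarrow> (\<forall>\<phi> I. test_fun B \<phi> \<longrightarrow>
     ip B (\<lambda>x. d x $ I) \<phi> = - (LINT x|lebesgue_on B. (\<Sum>J\<in>UNIV. T x $ I $ J * pd J \<phi> x)))"

text \<open>
  Permutation symbols on an index type with two, respectively three, elements, numbered by its
  linear order (e.g. the numeral types \<open>2\<close> and \<open>3\<close>).
\<close>

definition eps2 :: "'n::linorder \<Rightarrow> 'n \<Rightarrow> real" where
  "eps2 j k = (if j < k then 1 else if k < j then - 1 else 0)"

definition eps3 :: "'n::linorder \<Rightarrow> 'n \<Rightarrow> 'n \<Rightarrow> real" where
  "eps3 i j k = eps2 i j * eps2 i k * eps2 j k"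

text \<open>
  Row-wise curl. In the plane the curl of the row \<open>v\<close> is the scalar \<open>\<partial>\<^sub>1v\<^sub>2 - \<partial>\<^sub>2v\<^sub>1\<close>, so the curl of
  a tensor field is a vector field; in space it is the tensor field whose rows are the usual curls
  \<open>\<epsilon>\<^sub>j\<^sub>k\<^sub>l \<partial>\<^sub>kv\<^sub>l\<close>.
\<close>

definition weak_curl2 :: "'n region \<Rightarrow> 'n::{finite,linorder} tfield \<Rightarrow> 'n vfield \<Rightarrow> bool" where
  "weak_curl2 B T c \<longleftrightarrow> (\<forall>\<phi> I. test_fun B \<phi> \<longrightarrow>
     ip B (\<lambda>x. c x $ I) \<phi>
       = - (LINT x|lebesgue_on B. (\<Sum>K\<in>UNIV. \<Sum>L\<in>UNIV. eps2 K L * T x $ I $ L * pd K \<phi> x)))"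

definition weak_curl3 :: "'n region \<Rightarrow> 'n::{finite,linorder} tfield \<Rightarrow> 'n tfield \<Rightarrow> bool" where
  "weak_curl3 B T C \<longleftrightarrow> (\<forall>\<phi> I J. test_fun B \<phi> \<longrightarrow>
     ip B (\<lambda>x. C x $ I $ J) \<phi>
       = - (LINT x|lebesgue_on B. (\<Sum>K\<in>UNIV. \<Sum>L\<in>UNIV. eps3 J K L * T x $ I $ L * pd K \<phi> x)))"


subsection \<open>The spaces and their norms\<close>

definition H1 :: "'n region \<Rightarrow> 'n::finite sfield set" where
  "H1 B = {v \<in> L2 B. \<forall>j. \<exists>g\<in>L2 B. weak_pd B j v g}"

definition wpd :: "'n region \<Rightarrow> 'n \<Rightarrow> 'n::finite sfield \<Rightarrow> 'n sfield" where
  "wpd B j v = (SOME g. g \<in> L2 B \<and> weak_pd B j v g)"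

definition grad :: "'n region \<Rightarrow> 'n::finite vfield \<Rightarrow> 'n tfield" where
  "grad B v x = (\<chi> I J. wpd B J (\<lambda>x. v x $ I) x)"

definition H1_norm :: "'n region \<Rightarrow> 'n::finite sfield \<Rightarrow> real" where
  "H1_norm B v = sqrt ((l2_norm (lebesgue_on B) v)\<^sup>2 + (\<Sum>j\<in>UNIV. (l2_norm (lebesgue_on B) (wpd B j v))\<^sup>2))"

definition vec_fields :: "'n::finite sfield set \<Rightarrow> 'n vfield set" where
  "vec_fields S = {v. \<forall>I. (\<lambda>x. v x $ I) \<in> S}"

definition Hdiv :: "'n region \<Rightarrow> 'n::finite tfield set" where
  "Hdiv B = {T \<in> L2 B. \<exists>d\<in>L2 B. weak_div B T d}"

definition wdiv :: "'n region \<Rightarrow> 'n::finite tfield \<Rightarrow> 'n vfield" where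
  "wdiv B T = (SOME d. d \<in> L2 B \<and> weak_div B T d)"

definition Hcurl :: "'n region \<Rightarrow> 'n::{finite,linorder} tfield set" where
  "Hcurl B = {T \<in> L2 B. if CARD('n) = 2 then \<exists>c\<in>L2 B. weak_curl2 B T c
                                          else \<exists>C\<in>L2 B. weak_curl3 B T C}"

definition wcurl2 :: "'n region \<Rightarrow> 'n::{finite,linorder} tfield \<Rightarrow> 'n vfield" where
  "wcurl2 B T = (SOME c. c \<in> L2 B \<and> weak_curl2 B T c)"

definition wcurl3 :: "'n region \<Rightarrow> 'n::{finite,linorder} tfield \<Rightarrow> 'n tfield" where
  "wcurl3 B T = (SOME C. C \<in> L2 B \<and> weak_curl3 B T C)"

definition vec_H1_norm :: "'n region \<Rightarrow> 'n::finite vfield \<Rightarrow> real" where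
  "vec_H1_norm B v = sqrt (\<Sum>I\<in>UNIV. (H1_norm B (\<lambda>x. v x $ I))\<^sup>2)"

definition Hdiv_norm :: "'n region \<Rightarrow> 'n::finite tfield \<Rightarrow> real" where
  "Hdiv_norm B T = sqrt ((l2_norm (lebesgue_on B) T)\<^sup>2 + (l2_norm (lebesgue_on B) (wdiv B T))\<^sup>2)"

definition Hcurl_norm :: "'n region \<Rightarrow> 'n::{finite,linorder} tfield \<Rightarrow> real" where
  "Hcurl_norm B T = sqrt ((l2_norm (lebesgue_on B) T)\<^sup>2 +
     (if CARD('n) = 2 then (l2_norm (lebesgue_on B) (wcurl2 B T))\<^sup>2
                      else (l2_norm (lebesgue_on B) (wcurl3 B T))\<^sup>2))"


subsection \<open>Surface measure and boundary traces\<close>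

text \<open>
  Hausdorff measure of integer dimension \<open>s \<ge> 1\<close>, normalised to agree with \<open>s\<close>-dimensional area
  (the factor is 1 for \<open>s = 1\<close> and \<open>pi/4\<close> for \<open>s = 2\<close>).
\<close>

definition hausdorff_pre :: "nat \<Rightarrow> real \<Rightarrow> 'a::metric_space set \<Rightarrow> ennreal" where
  "hausdorff_pre s \<delta> A =
     (INF U\<in>{U::nat \<Rightarrow> 'a set. A \<subseteq> (\<Union>i. U i) \<and> (\<forall>i. bounded (U i) \<and> diameter (U i) \<le> \<delta>)}.
        \<Sum>i. ennreal (unit_ball_vol (real s) / 2 ^ s * diameter (U i) ^ s))"

definition hausdorff_outer :: "nat \<Rightarrow> 'a::metric_space set \<Rightarrow> ennreal" where
  "hausdorff_outer s A = (SUP \<delta>\<in>{0<..}. hausdorff_pre s \<delta> A)"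

definition surface_measure :: "'n region \<Rightarrow> (real^'n::finite) measure" where
  "surface_measure S =
     restrict_space (completion (measure_of UNIV (sets borel) (hausdorff_outer (CARD('n) - 1)))) S"

text \<open>
  The trace is the continuous extension to \<open>H\<^sup>1(B)\<close> of the restriction of smooth functions to the
  boundary, with values in \<open>L\<^sup>2\<close> of the boundary. It is unique almost everywhere on the boundary
  when \<open>B\<close> is a Lipschitz domain.
\<close>

definition has_trace :: "'n region \<Rightarrow> 'n::finite sfield \<Rightarrow> 'n sfield \<Rightarrow> bool" where
  "has_trace B v g \<longleftrightarrow> v \<in> H1 B \<and> (\<exists>\<phi>::nat \<Rightarrow> 'n sfield.
     (\<forall>k. smooth (\<phi> k) \<and> \<phi> k \<in> H1 B \<and> sq_int (surface_measure (frontier B)) (\<lambda>x. \<phi> k x - g x)) \<and>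
     (\<lambda>k. H1_norm B (\<lambda>x. \<phi> k x - v x)) \<longlonglongrightarrow> 0 \<and>
     (\<lambda>k. l2_norm (surface_measure (frontier B)) (\<lambda>x. \<phi> k x - g x)) \<longlonglongrightarrow> 0)"

definition btrace :: "'n region \<Rightarrow> 'n::finite sfield \<Rightarrow> 'n sfield" where
  "btrace B v = (SOME g. has_trace B v g)"

definition vec_btrace :: "'n region \<Rightarrow> 'n::finite vfield \<Rightarrow> 'n vfield" where
  "vec_btrace B v x = (\<chi> I. btrace B (\<lambda>x. v x $ I) x)"

definition eq_on_boundary ::
  "'n region \<Rightarrow> 'n region \<Rightarrow> 'n::finite sfield \<Rightarrow> 'n sfield \<Rightarrow> bool" where
  "eq_on_boundary B \<Gamma> v h \<longleftrightarrow>
     (\<exists>g. has_trace B v g \<and> (AE x in surface_measure (frontier B). x \<in> \<Gamma> \<longrightarrow> g x = h x))"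

definition H1_van :: "'n region \<Rightarrow> 'n region \<Rightarrow> 'n::finite sfield set" where
  "H1_van B \<Gamma> = {v \<in> H1 B. eq_on_boundary B \<Gamma> v (\<lambda>x. 0)}"


subsection \<open>Product spaces\<close>

definition Zbar :: "'n region \<Rightarrow> 'n::{finite,linorder} fields set" where
  "Zbar B = vec_fields (H1 B) \<times> Hcurl B \<times> Hdiv B \<times> L2 B"

definition Zspace :: "'n region \<Rightarrow> 'n region \<Rightarrow> 'n::{finite,linorder} fields set" where
  "Zspace B \<Gamma>1 = vec_fields (H1_van B \<Gamma>1) \<times> Hcurl B \<times> Hdiv B \<times> L2 B"

fun Z_norm :: "'n region \<Rightarrow> 'n::{finite,linorder} fields \<Rightarrow> real" where
  "Z_norm B (V, M, Q, r) = sqrt ((vec_H1_norm B V)\<^sup>2 + (Hcurl_norm B M)\<^sup>2 + (Hdiv_norm B Q)\<^sup>2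
                                  + (l2_norm (lebesgue_on B) r)\<^sup>2)"

fun Z_null :: "'n region \<Rightarrow> 'n::finite fields \<Rightarrow> bool" where
  "Z_null B (V, M, Q, r) \<longleftrightarrow> null_on B V \<and> null_on B M \<and> null_on B Q \<and> null_on B r"

fun Z_diff :: "'n::finite fields \<Rightarrow> 'n fields \<Rightarrow> 'n fields" where
  "Z_diff (V, M, Q, r) (V', M', Q', r') =
     (\<lambda>x. V x - V' x, \<lambda>x. M x - M' x, \<lambda>x. Q x - Q' x, \<lambda>x. r x - r' x)"


subsection \<open>Finite-dimensional subspaces\<close>

definition lin_subspace :: "('a \<Rightarrow> 'b::real_vector) set \<Rightarrow> bool" where
  "lin_subspace V \<longleftrightarrow> (\<lambda>x. 0) \<in> V \<and> (\<forall>f\<in>V. \<forall>g\<in>V. (\<lambda>x. f x + g x) \<in> V) \<and>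
     (\<forall>c. \<forall>f\<in>V. (\<lambda>x. c *\<^sub>R f x) \<in> V)"

text \<open>Existence of a basis with \<open>d\<close> elements, modulo null functions on \<open>B\<close>.\<close>

definition has_dim :: "'n region \<Rightarrow> (real^'n \<Rightarrow> 'b::euclidean_space) set \<Rightarrow> nat \<Rightarrow> bool" where
  "has_dim B V d \<longleftrightarrow> (\<exists>e::nat \<Rightarrow> real^'n \<Rightarrow> 'b. (\<forall>i<d. e i \<in> V) \<and>
     (\<forall>c::nat \<Rightarrow> real. null_on B (\<lambda>x. \<Sum>i<d. c i *\<^sub>R e i x) \<longrightarrow> (\<forall>i<d. c i = 0)) \<and>
     (\<forall>v\<in>V. \<exists>c::nat \<Rightarrow> real. null_on B (\<lambda>x. v x - (\<Sum>i<d. c i *\<^sub>R e i x))))"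

definition fin_dim_subspace ::
  "'n region \<Rightarrow> (real^'n \<Rightarrow> 'b::euclidean_space) set \<Rightarrow> (real^'n \<Rightarrow> 'b) set \<Rightarrow> bool" where
  "fin_dim_subspace B V W \<longleftrightarrow> V \<subseteq> W \<and> lin_subspace V \<and> (\<exists>d. has_dim B V d)"


subsection \<open>The four-field weak problem and its linearization\<close>

definition elast :: "'n tensor_map \<Rightarrow> real^'n^'n
    \<Rightarrow> 'n::finite \<Rightarrow> 'n \<Rightarrow> 'n \<Rightarrow> 'n \<Rightarrow> real" where
  "elast \<P> K I J R S = frechet_derivative \<P> (at K) (axis R (axis S 1)) $ I $ J"

definition elast_app :: "'n tensor_map \<Rightarrow> real^'n^'n \<Rightarrow> real^'n^'n \<Rightarrow> real^'n::finite^'n" where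
  "elast_app \<P> K M = (\<chi> I J. \<Sum>R\<in>UNIV. \<Sum>S\<in>UNIV. elast \<P> K I J R S * M $ R $ S)"

definition FinvT :: "real^'n^'n \<Rightarrow> real^'n::finite^'n" where
  "FinvT K = transpose (matrix_inv (mat 1 + K))"

fun Hform :: "'n region \<Rightarrow> 'n region \<Rightarrow> 'n tensor_map \<Rightarrow> 'n::finite vfield
    \<Rightarrow> 'n vfield \<Rightarrow> 'n fields \<Rightarrow> 'n fields \<Rightarrow> real" where
  "Hform B \<Gamma>2 \<P> F T (U, K, P, p) (\<Upsilon>, \<Lambda>, \<pi>, q) =
     ip B P (grad B \<Upsilon>) + ip B (grad B U) \<Lambda> - ip B K \<Lambda> + ip B (\<lambda>x. \<P> (K x)) \<pi> - ip B P \<pi>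
     - ip B (\<lambda>x. p x *\<^sub>R FinvT (K x)) \<pi> + ip B (\<lambda>x. det (mat 1 + K x)) q
     - ip B F \<Upsilon> - (LINT x:\<Gamma>2|surface_measure (frontier B). T x \<bullet> vec_btrace B \<Upsilon> x)
     - ip B (\<lambda>x. 1) q"

fun Hform_ok :: "'n region \<Rightarrow> 'n region \<Rightarrow> 'n tensor_map \<Rightarrow> 'n::finite vfield
    \<Rightarrow> 'n vfield \<Rightarrow> 'n fields \<Rightarrow> 'n fields \<Rightarrow> bool" where
  "Hform_ok B \<Gamma>2 \<P> F T (U, K, P, p) (\<Upsilon>, \<Lambda>, \<pi>, q) \<longleftrightarrow>
     ip_ok B P (grad B \<Upsilon>) \<and> ip_ok B (grad B U) \<Lambda> \<and> ip_ok B K \<Lambda> \<and> ip_ok B (\<lambda>x. \<P> (K x)) \<pi> \<and>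
     ip_ok B P \<pi> \<and> ip_ok B (\<lambda>x. p x *\<^sub>R FinvT (K x)) \<pi> \<and> ip_ok B (\<lambda>x. det (mat 1 + K x)) q \<and>
     ip_ok B F \<Upsilon> \<and>
     set_integrable (surface_measure (frontier B)) \<Gamma>2 (\<lambda>x. T x \<bullet> vec_btrace B \<Upsilon> x) \<and>
     ip_ok B (\<lambda>x. 1) q"

fun bform :: "'n region \<Rightarrow> 'n tensor_map
    \<Rightarrow> 'n::finite fields \<Rightarrow> 'n fields \<Rightarrow> 'n fields \<Rightarrow> real" where
  "bform B \<P> (U, K, P, p) (V, M, Q, r) (\<Upsilon>, \<Lambda>, \<pi>, q) =
     ip B Q (grad B \<Upsilon>) + ip B (grad B V) \<Lambda> - ip B M \<Lambda> + ip B (\<lambda>x. elast_app \<P> (K x) (M x)) \<pi> - ip B Q \<pi>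
     + ip B (\<lambda>x. p x *\<^sub>R (FinvT (K x) ** transpose (M x) ** FinvT (K x))) \<pi>
     - ip B (\<lambda>x. r x *\<^sub>R FinvT (K x)) \<pi>
     + ip B (\<lambda>x. det (mat 1 + K x) * trace (matrix_inv (mat 1 + K x) ** M x)) q"

fun bform_ok :: "'n region \<Rightarrow> 'n tensor_map
    \<Rightarrow> 'n::finite fields \<Rightarrow> 'n fields \<Rightarrow> 'n fields \<Rightarrow> bool" where
  "bform_ok B \<P> (U, K, P, p) (V, M, Q, r) (\<Upsilon>, \<Lambda>, \<pi>, q) \<longleftrightarrow>
     ip_ok B Q (grad B \<Upsilon>) \<and> ip_ok B (grad B V) \<Lambda> \<and> ip_ok B M \<Lambda> \<and>
     ip_ok B (\<lambda>x. elast_app \<P> (K x) (M x)) \<pi> \<and> ip_ok B Q \<pi> \<and>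
     ip_ok B (\<lambda>x. p x *\<^sub>R (FinvT (K x) ** transpose (M x) ** FinvT (K x))) \<pi> \<and>
     ip_ok B (\<lambda>x. r x *\<^sub>R FinvT (K x)) \<pi> \<and>
     ip_ok B (\<lambda>x. det (mat 1 + K x) * trace (matrix_inv (mat 1 + K x) ** M x)) q"

fun ae_invertible :: "'n region \<Rightarrow> 'n::finite fields \<Rightarrow> bool" where
  "ae_invertible B (U, K, P, p) \<longleftrightarrow> (AE x in lebesgue_on B. invertible (mat 1 + K x))"

fun displ_bc :: "'n region \<Rightarrow> 'n region \<Rightarrow> 'n::finite vfield \<Rightarrow> 'n fields \<Rightarrow> bool" where
  "displ_bc B \<Gamma>1 Ubar (U, K, P, p) \<longleftrightarrow> (\<forall>I. eq_on_boundary B \<Gamma>1 (\<lambda>x. U x $ I) (\<lambda>x. Ubar x $ I))"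

definition weak_solution :: "'n region \<Rightarrow> 'n region \<Rightarrow> 'n region
    \<Rightarrow> 'n tensor_map \<Rightarrow> 'n vfield \<Rightarrow> 'n vfield \<Rightarrow> 'n vfield
    \<Rightarrow> 'n::{finite,linorder} fields \<Rightarrow> bool" where
  "weak_solution B \<Gamma>1 \<Gamma>2 \<P> F Ubar T u \<longleftrightarrow>
     u \<in> Zbar B \<and> displ_bc B \<Gamma>1 Ubar u \<and>
     (\<forall>y\<in>Zspace B \<Gamma>1. Hform_ok B \<Gamma>2 \<P> F T u y \<and> Hform B \<Gamma>2 \<P> F T u y = 0)"

text \<open>
  Nonsingularity of the derivative means that the bilinear form is nondegenerate on both sides.
  Being an isomorphism onto the dual would be too much to ask: no functional
  \<open>\<lambda> \<mapsto> \<langle>grad V - M, \<lambda>\<rangle>\<close> represents, e.g., \<open>\<lambda> \<mapsto> \<langle>C, curl \<lambda>\<rangle>\<close> for a general \<open>C\<close> in \<open>L\<^sup>2\<close>.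
\<close>

definition nonsingular :: "'n region \<Rightarrow> 'n region \<Rightarrow> 'n tensor_map
    \<Rightarrow> 'n::{finite,linorder} fields \<Rightarrow> bool" where
  "nonsingular B \<Gamma>1 \<P> w \<longleftrightarrow>
     (\<forall>z\<in>Zspace B \<Gamma>1. \<forall>y\<in>Zspace B \<Gamma>1. bform_ok B \<P> w z y) \<and>
     (\<forall>z\<in>Zspace B \<Gamma>1. (\<forall>y\<in>Zspace B \<Gamma>1. bform B \<P> w z y = 0) \<longrightarrow> Z_null B z) \<and>
     (\<forall>y\<in>Zspace B \<Gamma>1. (\<forall>z\<in>Zspace B \<Gamma>1. bform B \<P> w z y = 0) \<longrightarrow> Z_null B y)"

definition regular_solution :: "'n region \<Rightarrow> 'n region \<Rightarrow> 'n region
    \<Rightarrow> 'n tensor_map \<Rightarrow> 'n vfield \<Rightarrow> 'n vfield \<Rightarrow> 'n vfield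
    \<Rightarrow> 'n::{finite,linorder} fields \<Rightarrow> bool" where
  "regular_solution B \<Gamma>1 \<Gamma>2 \<P> F Ubar T u \<longleftrightarrow>
     weak_solution B \<Gamma>1 \<Gamma>2 \<P> F Ubar T u \<and> nonsingular B \<Gamma>1 \<P> u"


subsection \<open>Discrete inf-sup condition and Newton step\<close>

definition inf_sup :: "'n region \<Rightarrow> 'n tensor_map
    \<Rightarrow> 'n::{finite,linorder} fields \<Rightarrow> 'n fields set \<Rightarrow> ereal" where
  "inf_sup B \<P> w Zh =
     (INF y\<in>{y \<in> Zh. \<not> Z_null B y}. SUP z\<in>{z \<in> Zh. \<not> Z_null B z}.
        ereal (bform B \<P> w z y / (Z_norm B z * Z_norm B y)))"

definition newton_step :: "'n region \<Rightarrow> 'n region \<Rightarrow> 'n tensor_map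
    \<Rightarrow> 'n vfield \<Rightarrow> 'n vfield \<Rightarrow> 'n fields \<Rightarrow> 'n::finite fields set \<Rightarrow> 'n fields \<Rightarrow> bool" where
  "newton_step B \<Gamma>2 \<P> F T w Zh z \<longleftrightarrow>
     z \<in> Zh \<and> (\<forall>y\<in>Zh. bform B \<P> w z y = - Hform B \<Gamma>2 \<P> F T w y)"

definition newton_uniquely_solvable :: "'n region \<Rightarrow> 'n region \<Rightarrow> 'n tensor_map
    \<Rightarrow> 'n vfield \<Rightarrow> 'n vfield \<Rightarrow> 'n fields \<Rightarrow> 'n::finite fields set \<Rightarrow> bool" where
  "newton_uniquely_solvable B \<Gamma>2 \<P> F T w Zh \<longleftrightarrow>
     (\<exists>z. newton_step B \<Gamma>2 \<P> F T w Zh z \<and>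
        (\<forall>z'. newton_step B \<Gamma>2 \<P> F T w Zh z' \<longrightarrow> Z_null B (Z_diff z' z)))"

end

theory Submission
  imports Defs
begin

text \<open>
  With respect to bases of the four factors of \<open>Z_h\<close>, the linearization is a square matrix with
  \<open>4 \<times> 4\<close> blocks, nine of which vanish identically. Each of the four inequalities makes a vanishing
  rectangle of blocks too large for a nonsingular matrix: (i) \<open>\<Upsilon>\<close> only sees \<open>Q\<close>; (ii) \<open>q\<close> only sees
  \<open>M\<close>; (iii) already \<open>n1 > nc\<close> suffices, because \<open>V\<close> only sees \<open>\<Lambda>\<close>; (iv) \<open>(\<Lambda>, q)\<close> only sees \<open>(V, M)\<close>.
  A test field in the kernel makes the infimum at most 0, and a trial field in the kernel
  can be added to any Newton step.

  Since elements are representatives of classes and \<^const>\<open>grad\<close> chooses weak derivatives, bilinearity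
  of the form rests on the almost everywhere uniqueness of weak derivatives, that is, on
  the fundamental lemma of the calculus of variations.
\<close>

subsection \<open>Smooth bump functions\<close>

text \<open>The two conclusions need kernels on opposite sides. The inf-sup constant is an infimum
  over test fields, so a test field annihilated by all trial fields is wanted, at the exact
  solution; failure of uniqueness wants a trial field annihilated by all test fields, at the
  iterate. Counting equations against unknowns in the vanishing rectangle gives the first. Trial and
  test space coincide, so the matrix is square and the second follows. The count depends on the
  linearization point only through finiteness of the integrals, so it serves \<open>u\<close> and
  \<open>u_hi\<close> alike. The counting is short. The obstacle is that the gradient of a
  combination and the combination of gradients are, as chosen functions, a priori unrelated. The
  domain is an arbitrary open set, so they are compared locally, on boxes inside it, with explicit
  bumps that are smooth in the sense of \<open>smooth\<close>. The trace is a limit relation, and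
  its linearity must be known before the constrained displacement space counts as a linear
  subspace.\<close>

lemma pd_eq: "(f has_derivative f') (at x) \<Longrightarrow> pd j f x = f' (axis j 1)"
  unfolding pd_def by (metis frechet_derivative_at)

section \<open>The classes \<open>Ck\<close> under sums and products\<close>

lemma Ck_Suc_D: "Ck (Suc k) f \<Longrightarrow> Ck k f"
proof (induction k arbitrary: f)
  case 0
  then show ?case
    by (auto simp: continuous_on_eq_continuous_within intro: differentiable_imp_continuous_within)
next
  case (Suc k)
  then show ?case by (metis Ck.simps(2))
qed

lemma pd_add:
  assumes "f differentiable (at x)" "g differentiable (at x)"
  shows "pd j (\<lambda>x. f x + g x) x = pd j f x + pd j g x"
  unfolding pd_eq[OF has_derivative_add[OF assms[unfolded frechet_derivative_works]]]
  by (simp add: pd_def)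

lemma pd_mult:
  assumes "f differentiable (at x)" "g differentiable (at x)"
  shows "pd j (\<lambda>x. f x * g x) x = f x * pd j g x + pd j f x * g x"
  unfolding pd_eq[OF has_derivative_mult[OF assms[unfolded frechet_derivative_works]]]
  by (simp add: pd_def)

lemma Ck_const [simp]: "Ck k (\<lambda>x. c)"
proof (induction k arbitrary: c)
  case (Suc k)
  have "pd j (\<lambda>x. c) = (\<lambda>x. 0)" for j :: 'a
    by (rule ext) (simp add: pd_def)
  then show ?case using Suc by simp
qed simp

lemma Ck_add: "Ck k f \<Longrightarrow> Ck k g \<Longrightarrow> Ck k (\<lambda>x. f x + g x)"
proof (induction k arbitrary: f g)
  case 0
  then show ?case by (simp add: continuous_on_add)
next
  case (Suc k)
  have "pd j (\<lambda>x. f x + g x) = (\<lambda>x. pd j f x + pd j g x)" for j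
    using Suc.prems by (auto simp: pd_add)
  then show ?case using Suc by simp
qed

lemma Ck_mult: "Ck k f \<Longrightarrow> Ck k g \<Longrightarrow> Ck k (\<lambda>x. f x * g x)"
proof (induction k arbitrary: f g)
  case 0
  then show ?case by (simp add: continuous_on_mult)
next
  case (Suc k)
  have "pd j (\<lambda>x. f x * g x) = (\<lambda>x. f x * pd j g x + pd j f x * g x)" for j
    using Suc.prems by (auto simp: pd_mult)
  moreover have "Ck k f" "Ck k g" using Suc.prems Ck_Suc_D by blast+
  ultimately show ?case using Suc by (auto intro!: Ck_add)
qed

lemma smooth_const [simp]: "smooth (\<lambda>x. c)"
  by (simp add: smooth_def)

lemma smooth_add: "smooth f \<Longrightarrow> smooth g \<Longrightarrow> smooth (\<lambda>x. f x + g x)"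
  by (simp add: smooth_def Ck_add)

lemma smooth_mult: "smooth f \<Longrightarrow> smooth g \<Longrightarrow> smooth (\<lambda>x. f x * g x)"
  by (simp add: smooth_def Ck_mult)

lemma smooth_diff: "smooth f \<Longrightarrow> smooth g \<Longrightarrow> smooth (\<lambda>x. f x - g x)"
  using smooth_add[of f "\<lambda>x. (-1) * g x"] smooth_mult[of "\<lambda>x. -1" g] by simp

lemma smooth_power: "smooth f \<Longrightarrow> smooth (\<lambda>x. f x ^ k)"
  by (induction k) (auto intro: smooth_mult)

lemma smooth_prod: "(\<And>i. i \<in> I \<Longrightarrow> smooth (f i)) \<Longrightarrow> smooth (\<lambda>x. \<Prod>i\<in>I. f i x)"
  by (induction I rule: infinite_finite_induct) (auto intro: smooth_mult)

lemma smooth_imp_pd: "smooth f \<Longrightarrow> smooth (pd j f)"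
  unfolding smooth_def by (metis Ck.simps(2))

lemma smooth_imp_continuous: "smooth f \<Longrightarrow> continuous_on UNIV f"
  unfolding smooth_def by (metis Ck.simps(1))

text \<open>The family is closed under differentiation up to linear combinations, which makes every
  member smooth.\<close>

definition flat_exp :: "nat \<Rightarrow> real \<Rightarrow> real" where
  "flat_exp m t = (if t > 0 then inverse t ^ m * exp (- inverse t) else 0)"

text \<open>Exponentials beat powers, after the substitution s = 1/t.\<close>

lemma flat_exp_tendsto: "((\<lambda>t. inverse t ^ m * exp (- inverse t)) \<longlongrightarrow> 0) (at_right (0::real))"
proof -
  have "((\<lambda>t. inverse t ^ m / exp (inverse t)) \<longlongrightarrow> 0) (at_right (0::real))"
    by (rule filterlim_compose[OF tendsto_power_div_exp_0 filterlim_inverse_at_top_right])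
  then show ?thesis by (simp add: exp_minus divide_inverse)
qed

text \<open>Away from 0 this is the product rule. At 0 the difference quotient vanishes identically
  on the left, and on the right it is a member of the same family.\<close>

lemma flat_exp_deriv:
  "(flat_exp m has_real_derivative (flat_exp (m + 2) t - real m * flat_exp (m + 1) t)) (at t)"
proof -
  consider "t > 0" | "t < 0" | "t = 0" by linarith
  then show ?thesis
  proof cases
    case 1
    have "((\<lambda>t. inverse t ^ m * exp (- inverse t)) has_real_derivative
        (inverse t ^ m * (exp (- inverse t) * (inverse t)\<^sup>2)
          + real m * (inverse t ^ (m - 1) * - (inverse t)\<^sup>2) * exp (- inverse t))) (at t)"
      using 1 by (auto intro!: derivative_eq_intros simp: power2_eq_square)
    \<comment> \<open>For \<open>m = 0\<close> the exponent \<open>m - 1\<close> is truncated to 0,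
      which is harmless because of the factor \<open>real m\<close>.\<close>
    also have "real m * (inverse t ^ (m - 1) * - (inverse t)\<^sup>2) = - real m * inverse t ^ (m + 1)"
      by (cases m) (simp_all add: power2_eq_square algebra_simps)
    finally have "((\<lambda>t. inverse t ^ m * exp (- inverse t)) has_real_derivative
        (flat_exp (m + 2) t - real m * flat_exp (m + 1) t)) (at t)"
      using 1 by (simp add: flat_exp_def power2_eq_square mult_ac)
    then show ?thesis
      by (rule has_field_derivative_transform_within_open[where S="{0<..}"])
         (use 1 in \<open>auto simp: flat_exp_def\<close>)
  next
    case 2
    have "((\<lambda>t. 0) has_real_derivative (flat_exp (m + 2) t - real m * flat_exp (m + 1) t)) (at t)"
      using 2 by (simp add: flat_exp_def)
    then show ?thesis
      by (rule has_field_derivative_transform_within_open[where S="{..<0}"])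
         (use 2 in \<open>auto simp: flat_exp_def\<close>)
  next
    case 3
    have "((\<lambda>y. flat_exp m y / y) \<longlongrightarrow> 0) (at_left 0)"
      by (rule tendsto_eventually) (auto simp: flat_exp_def eventually_at_filter)
    \<comment> \<open>Dividing by y raises the exponent by one, hence \<open>Suc m\<close>.\<close>
    moreover have "((\<lambda>y. flat_exp m y / y) \<longlongrightarrow> 0) (at_right 0)"
      by (rule Lim_transform_eventually[OF flat_exp_tendsto[of "Suc m"]])
         (auto simp: flat_exp_def eventually_at_filter divide_inverse)
    ultimately have "((\<lambda>y. flat_exp m y / y) \<longlongrightarrow> 0) (at 0)"
      by (simp add: filterlim_split_at)
    then show ?thesis using 3 by (simp add: has_field_derivative_iff flat_exp_def)
  qed
qed

lemma flat_exp_nonneg: "flat_exp m t \<ge> 0"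
  by (simp add: flat_exp_def)

lemma flat_exp_0_less_1: "flat_exp 0 t < 1"
  by (simp add: flat_exp_def)

text \<open>The affine argument covers both kinds of factor of a box bump: x_i - a_i with s = 1 and
  b_i - x_i with s = -1.\<close>

lemma has_derivative_flat_exp_coord:
  "((\<lambda>x. flat_exp m (s * (x $ i) + c)) has_derivative
    (\<lambda>h. (s * (h $ i)) * (flat_exp (m + 2) (s * (x $ i) + c) - real m * flat_exp (m + 1) (s * (x $ i) + c)))) (at x)"
proof -
  have "((\<lambda>x. s * (x $ i) + c) has_derivative (\<lambda>h. s * (h $ i))) (at x)"
    by (auto intro!: derivative_eq_intros bounded_linear_imp_has_derivative bounded_linear_vec_nth)
  from DERIV_compose_FDERIV[OF flat_exp_deriv this] show ?thesis by (simp add: mult.commute)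
qed

lemma Ck_flat_exp_coord: "Ck k (\<lambda>x. flat_exp m (s * (x $ i) + c))"
proof (induction k arbitrary: m)
  case 0
  show ?case
    by (auto simp: continuous_on_eq_continuous_within
        intro: has_derivative_continuous[OF has_derivative_flat_exp_coord])
next
  case (Suc k)
  have "pd j (\<lambda>x. flat_exp m (s * (x $ i) + c)) =
     (\<lambda>x. (s * (axis j 1 $ i)) * (flat_exp (m + 2) (s * (x $ i) + c) + (- real m) * flat_exp (m + 1) (s * (x $ i) + c)))" for j
    by (rule ext) (simp add: pd_eq[OF has_derivative_flat_exp_coord])
  moreover have "(\<lambda>x. flat_exp m (s * (x $ i) + c)) differentiable (at x)" for x
    using has_derivative_flat_exp_coord differentiableI by blast
  ultimately show ?case
    by (simp only: Ck.simps simp_thms Ck_mult Ck_add Ck_const Suc.IH)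
qed

text \<open>The factors \<open>1 *\<close> and \<open>(-1) *\<close> keep every term literally in
  the affine shape of \<open>Ck_flat_exp_coord\<close>.\<close>

definition box_bump :: "real^'n \<Rightarrow> real^'n \<Rightarrow> 'n::finite sfield" where
  "box_bump a b x = (\<Prod>i\<in>UNIV. flat_exp 0 (1 * (x $ i) + (- a $ i)) * flat_exp 0 ((-1) * (x $ i) + b $ i))"

lemma smooth_box_bump: "smooth (box_bump a b)"
  unfolding box_bump_def[abs_def]
  by (intro smooth_prod smooth_mult) (simp_all only: smooth_def Ck_flat_exp_coord simp_thms)

lemma box_bump_nonneg: "box_bump a b x \<ge> 0"
  unfolding box_bump_def by (intro prod_nonneg mult_nonneg_nonneg flat_exp_nonneg ballI)

lemma box_bump_less_1: "box_bump a b x < 1"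
proof -
  have "(\<Prod>i\<in>UNIV. flat_exp 0 (1 * (x $ i) + (- a $ i)) * flat_exp 0 ((-1) * (x $ i) + b $ i)) < (\<Prod>i\<in>(UNIV::'a set). 1)"
  \<comment> \<open>One index with a strict inequality is required; the index type is nonempty, so
    any element will do.\<close>
  proof (rule prod_mono_strict[where i = undefined])
    have *: "0 \<le> flat_exp 0 s * flat_exp 0 t" "flat_exp 0 s * flat_exp 0 t < 1" for s t
      using mult_strict_mono'[OF flat_exp_0_less_1[of s] flat_exp_0_less_1[of t]]
      by (simp_all add: flat_exp_nonneg)
    show "flat_exp 0 (1 * (x $ undefined) + (- a $ undefined)) * flat_exp 0 ((-1) * (x $ undefined) + b $ undefined) < 1"
      by (rule *)
    show "0 \<le> flat_exp 0 (1 * (x $ i) + (- a $ i)) * flat_exp 0 ((-1) * (x $ i) + b $ i) \<and>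
        flat_exp 0 (1 * (x $ i) + (- a $ i)) * flat_exp 0 ((-1) * (x $ i) + b $ i) \<le> 1" for i
      using * less_imp_le by blast
  qed auto
  then show ?thesis by (simp add: box_bump_def)
qed

lemma box_bump_eq_0_iff: "box_bump a b x = 0 \<longleftrightarrow> x \<notin> box a b"
proof -
  have *: "flat_exp 0 t = 0 \<longleftrightarrow> t \<le> 0" for t by (simp add: flat_exp_def)
  show ?thesis by (auto simp: box_bump_def * mem_box_cart not_less)
qed

subsection \<open>The fundamental lemma of the calculus of variations\<close>

lemma integrable_L2_mult:
  assumes "f \<in> L2 B" "g \<in> L2 B"
  shows "integrable (lebesgue_on B) (\<lambda>x. f x * g x :: real)"
proof (rule Bochner_Integration.integrable_bound)
  show "integrable (lebesgue_on B) (\<lambda>x. (norm (f x))\<^sup>2 + (norm (g x))\<^sup>2)"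
    using assms by (auto simp: L2_def sq_int_def)
  show "(\<lambda>x. f x * g x) \<in> borel_measurable (lebesgue_on B)"
    using assms by (auto simp: L2_def sq_int_def)
  have "\<bar>a * b\<bar> \<le> a\<^sup>2 + b\<^sup>2" for a b :: real
  proof -
    have "0 \<le> (\<bar>a\<bar> - \<bar>b\<bar>)\<^sup>2" "0 \<le> \<bar>a * b\<bar>" by simp_all
    then show ?thesis unfolding power2_diff abs_mult power2_abs by linarith
  qed
  then show "AE x in lebesgue_on B. norm (f x * g x) \<le> norm ((norm (f x))\<^sup>2 + (norm (g x))\<^sup>2)"
    by auto
qed

text \<open>A relation between three representatives instead of an identity of functions: this is
  the form of linearity that survives the arbitrary choice of weak derivatives.\<close>

definition ae_lin ::
  "'n region \<Rightarrow> real \<Rightarrow> (real^'n \<Rightarrow> 'b::euclidean_space) \<Rightarrow> real \<Rightarrow> (real^'n \<Rightarrow> 'b) \<Rightarrow> (real^'n \<Rightarrow> 'b) \<Rightarrow> bool" where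
  "ae_lin B a f b g h \<longleftrightarrow> (AE x in lebesgue_on B. h x = a *\<^sub>R f x + b *\<^sub>R g x)"

lemma ae_linI: "(\<And>x. h x = a *\<^sub>R f x + b *\<^sub>R g x) \<Longrightarrow> ae_lin B a f b g h"
  by (simp add: ae_lin_def)

text \<open>The linear map may vary with the point, so projections to components and the
  coefficients built from \<open>K x\<close> and \<open>p x\<close> are treated alike.\<close>

lemma ae_lin_map:
  assumes "ae_lin B a f b g h" "\<And>x. linear (L x)"
  shows "ae_lin B a (\<lambda>x. L x (f x)) b (\<lambda>x. L x (g x)) (\<lambda>x. L x (h x))"
  using assms(1) unfolding ae_lin_def
  by eventually_elim (simp add: linear_add[OF assms(2)] linear_cmul[OF assms(2)])

text \<open>Integrability is required of each pairing separately: the integrands may be nonlinear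
  expressions outside L2, and a non-integrable function has integral 0 by convention, which would
  break additivity.\<close>

lemma ip_lin_left:
  assumes "ae_lin B a f b g h" "ip_ok B f k" "ip_ok B g k" "ip_ok B h k"
  shows "ip B h k = a * ip B f k + b * ip B g k"
proof -
  have "(LINT x|lebesgue_on B. h x \<bullet> k x - (a * (f x \<bullet> k x) + b * (g x \<bullet> k x))) = 0"
    using assms(1) by (intro integral_eq_zero_AE) (auto simp: ae_lin_def inner_add_left elim: eventually_mono)
  then show ?thesis using assms(2-4) by (simp add: ip_def ip_ok_def)
qed

lemma ip_commute: "ip B f g = ip B g f"
  by (simp add: ip_def inner_commute)

lemma ip_ok_commute: "ip_ok B f g = ip_ok B g f"
  by (simp add: ip_ok_def inner_commute)

lemma ip_lin_right:
  assumes "ae_lin B a f b g h" "ip_ok B k f" "ip_ok B k g" "ip_ok B k h"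
  shows "ip B k h = a * ip B k f + b * ip B k g"
  using ip_lin_left[OF assms(1)] assms(2-4) by (simp add: ip_commute[of _ k] ip_ok_commute[of _ k])

text \<open>From (s + t)^2 <= 2 s^2 + 2 t^2. A bound between squares can be integrated and summed
  term by term, so it takes the place of the triangle inequality for the L2 and H1 norms.\<close>

lemma norm_sq_lin_le:
  "(norm (a *\<^sub>R x + b *\<^sub>R y))\<^sup>2 \<le> 2 * a\<^sup>2 * (norm x)\<^sup>2 + 2 * b\<^sup>2 * (norm y)\<^sup>2"
  for x y :: "'b::real_normed_vector"
proof -
  have "norm (a *\<^sub>R x + b *\<^sub>R y) \<le> \<bar>a\<bar> * norm x + \<bar>b\<bar> * norm y"
    by (metis norm_scaleR norm_triangle_ineq)
  then have "(norm (a *\<^sub>R x + b *\<^sub>R y))\<^sup>2 \<le> (\<bar>a\<bar> * norm x + \<bar>b\<bar> * norm y)\<^sup>2"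
    by (rule power_mono) simp
  also have "\<dots> \<le> 2 * a\<^sup>2 * (norm x)\<^sup>2 + 2 * b\<^sup>2 * (norm y)\<^sup>2"
    using zero_le_power2[of "\<bar>a\<bar> * norm x - \<bar>b\<bar> * norm y"]
    by (simp add: power2_sum power2_diff power_mult_distrib)
  finally show ?thesis .
qed

lemma sq_int_lin:
  assumes "sq_int M f" "sq_int M g"
  shows "sq_int M (\<lambda>x. a *\<^sub>R f x + b *\<^sub>R g x)"
proof -
  have m: "(\<lambda>x. a *\<^sub>R f x + b *\<^sub>R g x) \<in> borel_measurable M"
    using assms by (auto simp: sq_int_def)
  have "integrable M (\<lambda>x. (norm (a *\<^sub>R f x + b *\<^sub>R g x))\<^sup>2)"
  proof (rule Bochner_Integration.integrable_bound)
    show "integrable M (\<lambda>x. 2 * a\<^sup>2 * (norm (f x))\<^sup>2 + 2 * b\<^sup>2 * (norm (g x))\<^sup>2)"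
      using assms by (auto simp: sq_int_def)
    show "AE x in M. norm ((norm (a *\<^sub>R f x + b *\<^sub>R g x))\<^sup>2)
        \<le> norm (2 * a\<^sup>2 * (norm (f x))\<^sup>2 + 2 * b\<^sup>2 * (norm (g x))\<^sup>2)"
      using norm_sq_lin_le by (auto intro!: AE_I2 intro: order_trans[OF _ abs_ge_self])
  qed (use m in measurable)
  with m show ?thesis by (simp add: sq_int_def)
qed

lemma L2_lin: "f \<in> L2 B \<Longrightarrow> g \<in> L2 B \<Longrightarrow> (\<lambda>x. a *\<^sub>R f x + b *\<^sub>R g x) \<in> L2 B"
  by (simp add: L2_def sq_int_lin)

lemma l2_norm_sq: "(l2_norm M f)\<^sup>2 = (LINT x|M. (norm (f x))\<^sup>2)"
  by (simp add: l2_norm_def)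

lemma l2_norm_lin_le:
  assumes "sq_int M f" "sq_int M g" "sq_int M h" "AE x in M. h x = a *\<^sub>R f x + b *\<^sub>R g x"
  shows "(l2_norm M h)\<^sup>2 \<le> 2 * a\<^sup>2 * (l2_norm M f)\<^sup>2 + 2 * b\<^sup>2 * (l2_norm M g)\<^sup>2"
proof -
  have "(LINT x|M. (norm (h x))\<^sup>2) \<le> (LINT x|M. 2 * a\<^sup>2 * (norm (f x))\<^sup>2 + 2 * b\<^sup>2 * (norm (g x))\<^sup>2)"
  proof (rule integral_mono_AE)
    show "AE x in M. (norm (h x))\<^sup>2 \<le> 2 * a\<^sup>2 * (norm (f x))\<^sup>2 + 2 * b\<^sup>2 * (norm (g x))\<^sup>2"
      using assms(4) by eventually_elim (simp only: norm_sq_lin_le)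
  qed (use assms in \<open>auto simp: sq_int_def\<close>)
  then show ?thesis using assms by (simp add: l2_norm_sq sq_int_def)
qed

section \<open>Square integrability of test functions\<close>

lemma continuous_compact_support_L2:
  fixes f :: "real^'n::finite \<Rightarrow> real"
  assumes "continuous_on UNIV f" "compact K" "\<And>x. x \<notin> K \<Longrightarrow> f x = 0" "B \<in> sets lebesgue"
  shows "f \<in> L2 B"
proof -
  have m: "f \<in> borel_measurable (lebesgue_on B)"
    using assms(1) by (intro measurable_restrict_space1 measurable_completion) (simp add: borel_measurable_continuous_onI)
  have "compact (f ` K)"
    using assms compact_continuous_image continuous_on_subset by blast
  then obtain C where C: "\<And>x. x \<in> K \<Longrightarrow> \<bar>f x\<bar> \<le> C"
    by (force dest!: compact_imp_bounded simp: bounded_iff)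
  have "integrable (lebesgue_on B) (\<lambda>x. (norm (f x))\<^sup>2)"
  proof (rule Bochner_Integration.integrable_bound)
    have K: "K \<in> sets lebesgue" using assms(2) lmeasurable_compact by blast
    \<comment> \<open>\<open>B\<close> may have infinite measure and \<open>K\<close> need not lie
      inside it; only the part of \<open>K\<close> in \<open>B\<close> is measured.\<close>
    have "K \<inter> B \<in> lmeasurable"
      by (rule fmeasurable_Int_fmeasurable[OF lmeasurable_compact[OF assms(2)] assms(4)])
    then have "emeasure lebesgue (K \<inter> B) < \<infinity>"
      by (simp add: fmeasurable_def del: emeasure_completion)
    then have "integrable (lebesgue_on B) (indicat_real (K \<inter> B))"
      using K assms(4) by (intro integrable_real_indicator) (auto simp: sets_restrict_space emeasure_restrict_space simp del: emeasure_completion)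
    then have "integrable (lebesgue_on B) (indicat_real K)"
      by (rule Bochner_Integration.integrable_cong[THEN iffD1, rotated 2]) (auto simp: indicator_def)
    then show "integrable (lebesgue_on B) (\<lambda>x. C\<^sup>2 * indicat_real K x)"
      by simp
    have "(norm (f x))\<^sup>2 \<le> C\<^sup>2 * indicat_real K x" for x
      using C[of x] assms(3)[of x] power_mono[of "\<bar>f x\<bar>" C 2] by (cases "x \<in> K") auto
    then show "AE x in lebesgue_on B. norm ((norm (f x))\<^sup>2) \<le> norm (C\<^sup>2 * indicat_real K x)"
      by (auto intro!: AE_I2 intro: order_trans[OF _ abs_ge_self])
  qed (use m in auto)
  with m show ?thesis by (simp add: L2_def sq_int_def)
qed

lemma test_fun_L2:
  assumes "test_fun B \<phi>" "B \<in> sets lebesgue"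
  shows "\<phi> \<in> L2 B" "pd j \<phi> \<in> L2 B"
proof -
  let ?K = "closure {x. \<phi> x \<noteq> 0}"
  have s: "smooth \<phi>" and K: "compact ?K" using assms by (auto simp: test_fun_def)
  have 0: "x \<notin> ?K \<Longrightarrow> \<phi> x = 0" for x
    using closure_subset[of "{x. \<phi> x \<noteq> 0}"] by blast
  show "\<phi> \<in> L2 B"
    using smooth_imp_continuous[OF s] K 0 assms(2) by (rule continuous_compact_support_L2)
  \<comment> \<open>Off its closed support the function vanishes on a whole neighbourhood, so its
    derivative is 0 there too.\<close>
  have 1: "pd j \<phi> x = 0" if x: "x \<notin> ?K" for x
  proof -
    have "((\<lambda>x. 0) has_derivative (\<lambda>h. 0)) (at x)" by simp
    moreover have "open (- ?K)" by (rule open_Compl[OF closed_closure])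
    moreover have "x \<in> - ?K" using x by simp
    moreover have "0 = \<phi> y" if "y \<in> - ?K" for y
      using that by (intro 0[symmetric]) blast
    ultimately have "(\<phi> has_derivative (\<lambda>h. 0)) (at x)"
      by (rule has_derivative_transform_within_open)
    then show ?thesis by (rule pd_eq)
  qed
  show "pd j \<phi> \<in> L2 B"
    using smooth_imp_continuous[OF smooth_imp_pd[OF s]] K 1 assms(2) by (rule continuous_compact_support_L2)
qed

lemma ip_ok_L2: "f \<in> L2 B \<Longrightarrow> g \<in> L2 B \<Longrightarrow> ip_ok B f (g :: _ \<Rightarrow> real)"
  unfolding ip_ok_def by (simp add: integrable_L2_mult)

text \<open>An L2 function need not be integrable over \<open>B\<close>, but it is on a bounded box,
  as the product with an L2 indicator. The indicator of the open box is no test function, only a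
  bounded pointwise limit of test functions, so orthogonality passes to it by dominated
  convergence.\<close>

lemma integral_box_eq_0:
  fixes g :: "'n::finite sfield"
  assumes g: "g \<in> L2 B" and 0: "\<And>\<phi>. test_fun B \<phi> \<Longrightarrow> ip B g \<phi> = 0"
    and ab: "cbox a b \<subseteq> B" and B: "B \<in> sets lebesgue"
  shows "integrable (lebesgue_on B) (\<lambda>x. g x * indicator (cbox a b) x)"
    and "(LINT x|lebesgue_on B. g x * indicator (box a b) x) = 0"
proof -
  have "indicat_real (cbox a b) \<in> borel_measurable (lebesgue_on B)"
    by (intro measurable_restrict_space1 measurable_completion) simp
  moreover have "integrable (lebesgue_on B) (\<lambda>x. (norm (indicat_real (cbox a b) x))\<^sup>2)"
  proof -
    have "integrable (lebesgue_on B) (indicat_real (cbox a b))"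
      using B ab emeasure_lborel_cbox_finite[of a b] by (intro integrable_real_indicator)
        (auto simp: sets_restrict_space emeasure_restrict_space inf.absorb2 intro!: image_eqI[of _ _ "cbox a b"])
    moreover have "(norm (indicat_real (cbox a b) x))\<^sup>2 = indicat_real (cbox a b) x" for x
      by (simp add: indicator_def)
    ultimately show ?thesis by simp
  qed
  ultimately have "indicat_real (cbox a b) \<in> L2 B" by (simp add: L2_def sq_int_def)
  from integrable_L2_mult[OF g this]
  show int: "integrable (lebesgue_on B) (\<lambda>x. g x * indicator (cbox a b) x)" .
  \<comment> \<open>Inside the box \<open>1 - box_bump a b x\<close> lies strictly between 0 and 1,
    so its powers tend to 0; outside it is 1. Hence these polynomials in the bump increase to the
    indicator of the open box.\<close>
  define \<phi> where "\<phi> k x = 1 - (1 - box_bump a b x) ^ k" for k :: nat and x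
  have test: "test_fun B (\<phi> k)" for k
  proof -
    have "{x. \<phi> k x \<noteq> 0} \<subseteq> cbox a b"
    proof safe
      fix x assume "\<phi> k x \<noteq> 0"
      then have "box_bump a b x \<noteq> 0" by (auto simp: \<phi>_def)
      then show "x \<in> cbox a b" using box_subset_cbox[of a b] by (auto simp: box_bump_eq_0_iff)
    qed
    then have "closure {x. \<phi> k x \<noteq> 0} \<subseteq> cbox a b"
      by (intro closure_minimal closed_cbox)
    moreover from this have "compact (closure {x. \<phi> k x \<noteq> 0})"
      by (meson bounded_cbox bounded_subset closed_closure compact_eq_bounded_closed)
    moreover have "smooth (\<phi> k)"
      unfolding \<phi>_def[abs_def] by (intro smooth_diff smooth_const smooth_power smooth_box_bump)
    ultimately show ?thesis using ab by (auto simp: test_fun_def)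
  qed
  have gm: "g \<in> borel_measurable (lebesgue_on B)" using g by (simp add: L2_def sq_int_def)
  have "(\<lambda>k. LINT x|lebesgue_on B. g x * \<phi> k x) \<longlonglongrightarrow> (LINT x|lebesgue_on B. g x * indicator (box a b) x)"
  proof (rule integral_dominated_convergence)
    have "indicat_real (box a b) \<in> borel_measurable (lebesgue_on B)"
      by (intro measurable_restrict_space1 measurable_completion) simp
    then show "(\<lambda>x. g x * indicator (box a b) x) \<in> borel_measurable (lebesgue_on B)"
      using gm by measurable
    show "(\<lambda>x. g x * \<phi> k x) \<in> borel_measurable (lebesgue_on B)" for k
      using gm test_fun_L2(1)[OF test B, of k] by (auto simp: L2_def sq_int_def)
    show "integrable (lebesgue_on B) (\<lambda>x. norm (g x * indicator (cbox a b) x))"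
      using int by (rule integrable_norm)
    show "AE x in lebesgue_on B. (\<lambda>k. g x * \<phi> k x) \<longlonglongrightarrow> g x * indicator (box a b) x"
    proof (intro AE_I2 tendsto_mult tendsto_const)
      fix x
      show "(\<lambda>k. \<phi> k x) \<longlonglongrightarrow> indicator (box a b) x"
      proof (cases "x \<in> box a b")
        case True
        have "(\<lambda>k. (1 - box_bump a b x) ^ k) \<longlonglongrightarrow> 0"
          using True box_bump_nonneg[of a b x] box_bump_eq_0_iff[of a b x] box_bump_less_1[of a b x]
          by (intro LIMSEQ_power_zero) auto
        from tendsto_diff[OF tendsto_const[of 1] this] show ?thesis
          using True by (simp add: \<phi>_def)
      next
        case False
        then show ?thesis by (simp add: \<phi>_def box_bump_eq_0_iff[THEN iffD2])
      qed
    qed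
    have "\<bar>\<phi> k x\<bar> \<le> indicator (cbox a b) x" for k x
    proof (cases "x \<in> cbox a b")
      case True
      have "0 \<le> (1 - box_bump a b x) ^ k" "(1 - box_bump a b x) ^ k \<le> 1"
        using box_bump_nonneg[of a b x] box_bump_less_1[of a b x] by (auto intro!: power_le_one)
      then show ?thesis using True by (simp add: \<phi>_def)
    next
      case False
      then have "x \<notin> box a b" using box_subset_cbox by blast
      then show ?thesis using False by (simp add: \<phi>_def box_bump_eq_0_iff[THEN iffD2])
    qed
    then show "AE x in lebesgue_on B. norm (g x * \<phi> k x) \<le> norm (g x * indicator (cbox a b) x)" for k
      by (auto simp: abs_mult intro!: mult_left_mono AE_I2)
  qed
  moreover have "(LINT x|lebesgue_on B. g x * \<phi> k x) = 0" for k
    using 0[OF test[of k]] by (simp add: ip_def)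
  ultimately show "(LINT x|lebesgue_on B. g x * indicator (box a b) x) = 0"
    using LIMSEQ_unique[OF tendsto_const] by fastforce
qed

text \<open>A pi-lambda argument: boxes are stable under intersection and generate the Borel sets.
  Since \<open>f\<close> has no sign, it runs on the integrals themselves; once the integral over
  every measurable set is 0, so is \<open>f\<close> almost everywhere.\<close>

lemma integral_boxes_0_imp_AE_0:
  fixes f :: "'n::finite sfield"
  assumes int: "integrable lebesgue f"
    and box: "\<And>a b. (LINT x|lebesgue. f x * indicator (box a b) x) = 0"
  shows "AE x in lebesgue. f x = 0"
proof (rule sigma_finite_measure.density_zero[OF _ int])
  show "sigma_finite_measure (lebesgue :: (real^'n) measure)"
  proof
    obtain A :: "(real^'n) set set" where "countable A" "A \<subseteq> sets lborel" "\<Union>A = space lborel"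
        "\<forall>a\<in>A. emeasure lborel a \<noteq> \<infinity>"
      using lborel.sigma_finite_countable by metis
    then show "\<exists>A. countable A \<and> A \<subseteq> sets (lebesgue :: (real^'n) measure) \<and> \<Union>A = space lebesgue
        \<and> (\<forall>a\<in>A. emeasure lebesgue a \<noteq> \<infinity>)"
      by (intro exI[of _ A]) (auto simp: subset_iff)
  qed
next
  have intA: "integrable lebesgue (\<lambda>x. f x * indicator A x)" if "A \<in> sets lebesgue" for A
    using integrable_mult_indicator[OF that int] by (simp add: mult.commute)
  have UN: "(LINT x|lebesgue. f x * indicator (\<Union>i. A i) x) = 0"
    if A: "\<And>i::nat. A i \<in> sets lebesgue" "disjoint_family A"
      "\<And>i. (LINT x|lebesgue. f x * indicator (A i) x) = 0" for A
  proof -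
    have "set_lebesgue_integral lebesgue (\<Union>i. A i) f = (\<Sum>i. set_lebesgue_integral lebesgue (A i) f)"
      using A intA[of "\<Union>i. A i"]
      by (intro lebesgue_integral_countable_add) (auto simp: disjoint_family_on_def set_integrable_def mult.commute)
    then show ?thesis using A by (simp add: set_lebesgue_integral_def mult.commute)
  qed
  \<comment> \<open>Passing to complements needs the integral over the whole space, obtained as a
    limit over growing boxes with majorant |f|.\<close>
  have tot: "(LINT x|lebesgue. f x) = 0"
  proof -
    have "(\<lambda>k. LINT x|lebesgue. f x * indicator (box (- (real k *\<^sub>R One)) (real k *\<^sub>R One)) x) \<longlonglongrightarrow> (LINT x|lebesgue. f x)"
    proof (rule integral_dominated_convergence[where w="\<lambda>x. norm (f x)"])
      show "AE x in lebesgue. (\<lambda>k. f x * indicator (box (- (real k *\<^sub>R One)) (real k *\<^sub>R One)) x) \<longlonglongrightarrow> f x"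
      proof (rule AE_I2)
        fix x :: "real^'n"
        have "eventually (\<lambda>k. x \<in> box (- (real k *\<^sub>R One)) (real k *\<^sub>R One)) sequentially"
        proof -
          obtain N :: nat where N: "norm x < real N" using reals_Archimedean2 by blast
          have "x \<in> box (- (real k *\<^sub>R One)) (real k *\<^sub>R One)" if "k \<ge> N" for k
            using N that Basis_le_norm[of _ x] by (fastforce simp: mem_box abs_less_iff)
          then show ?thesis using eventually_sequentially by blast
        qed
        then have "eventually (\<lambda>k. f x * indicator (box (- (real k *\<^sub>R One)) (real k *\<^sub>R One)) x = f x) sequentially"
          by eventually_elim simp
        then show "(\<lambda>k. f x * indicator (box (- (real k *\<^sub>R One)) (real k *\<^sub>R One)) x) \<longlonglongrightarrow> f x"
          by (rule tendsto_eventually)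
      qed
    next
      show "(\<lambda>x. f x * indicator (box (- (real k *\<^sub>R One)) (real k *\<^sub>R One)) x) \<in> borel_measurable lebesgue" for k
        by (intro borel_measurable_integrable intA) simp
    qed (use int in \<open>auto simp: indicator_def\<close>)
    then show ?thesis using box LIMSEQ_unique[OF tendsto_const] by fastforce
  qed
  have borel: "(LINT x|lebesgue. f x * indicator A x) = 0" if "A \<in> sets borel" for A
  proof -
    have sets: "sigma_sets UNIV (range (\<lambda>(a, b). box a b)) = sets (borel :: (real^'n) measure)"
      by (simp add: borel_eq_box)
    have "Int_stable (range (\<lambda>(a, b). box a b :: (real^'n) set))"
      by (auto simp: Int_stable_def box_Int_box)
    moreover have "range (\<lambda>(a, b). box a b) \<subseteq> Pow (UNIV :: (real^'n) set)" by simp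
    moreover have "A \<in> sigma_sets UNIV (range (\<lambda>(a, b). box a b))" using that sets by simp
    ultimately show ?thesis
    proof (induction rule: sigma_sets_induct_disjoint)
      case (compl A)
      have "(LINT x|lebesgue. f x * indicator (UNIV - A) x) = (LINT x|lebesgue. f x - f x * indicator A x)"
        by (intro Bochner_Integration.integral_cong) (auto simp: indicator_def)
      also have "\<dots> = 0" using compl sets intA[of A] int tot by auto
      finally show ?case by simp
    next
      case (union A)
      then show ?case using UN[of A] sets by auto
    qed (use box in auto)
  qed
  \<comment> \<open>A Lebesgue set differs from a Borel set by part of a Borel null set, so the
    Borel case carries over.\<close>
  fix A :: "(real^'n) set" assume "A \<in> sets lebesgue"
  then obtain S N N' where SN: "A = S \<union> N" "N \<subseteq> N'" "N' \<in> null_sets lborel" "S \<in> sets lborel"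
    using sets_completionE[of A lborel] by blast
  have "AE x in lebesgue. x \<notin> N'"
    using SN(3) by (intro AE_not_in) (simp add: null_sets_completionI)
  then have "AE x in lebesgue. f x * indicator A x = f x * indicator S x"
    by eventually_elim (use SN in \<open>auto simp: indicator_def\<close>)
  then have "(LINT x|lebesgue. f x * indicator A x) = (LINT x|lebesgue. f x * indicator S x)"
    using intA[of A] intA[of S] \<open>A \<in> sets lebesgue\<close> SN(4)
    by (intro integral_cong_AE) auto
  also have "\<dots> = 0" using borel SN(4) by simp
  finally show "set_lebesgue_integral lebesgue A f = 0"
    by (simp add: set_lebesgue_integral_def mult.commute)
qed

text \<open>The fundamental lemma. On a closed box inside \<open>B\<close> the truncated function is
  integrable over the whole space and its integrals over all boxes vanish; countably many such
  closed boxes exhaust the open set \<open>B\<close>.\<close>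

lemma test_fun_orthogonal_imp_AE_0:
  fixes g :: "'n::finite sfield"
  assumes g: "g \<in> L2 B" and 0: "\<And>\<phi>. test_fun B \<phi> \<Longrightarrow> ip B g \<phi> = 0" and B: "open B"
  shows "AE x in lebesgue_on B. g x = 0"
proof -
  have Bl: "B \<in> sets lebesgue" using B by auto
  have local: "AE x in lebesgue. x \<in> cbox a b \<longrightarrow> g x = 0" if ab: "cbox a b \<subseteq> B" for a b
  proof -
    have eq: "(LINT x|lebesgue. (g x * indicator (box a b) x) * indicator S x) =
        (LINT x|lebesgue_on B. g x * indicator (box a b \<inter> S) x)" for S
    proof -
      have "(LINT x|lebesgue_on B. g x * indicator (box a b \<inter> S) x) =
          (LINT x|lebesgue. indicator B x *\<^sub>R (g x * indicator (box a b \<inter> S) x))"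
        using Bl by (subst integral_restrict_space) auto
      also have "\<dots> = (LINT x|lebesgue. (g x * indicator (box a b) x) * indicator S x)"
        using ab box_subset_cbox[of a b] by (intro Bochner_Integration.integral_cong) (auto simp: indicator_def)
      finally show ?thesis by simp
    qed
    have "integrable (lebesgue_on B) (\<lambda>x. g x * indicator (cbox a b) x)"
      by (rule integral_box_eq_0(1)[OF g 0 ab Bl])
    then have "integrable lebesgue (\<lambda>x. indicator B x *\<^sub>R (g x * indicator (cbox a b) x))"
      using Bl by (subst (asm) integrable_restrict_space) auto
    from integrable_mult_indicator[OF _ this, of "box a b"]
    have "integrable lebesgue (\<lambda>x. indicator (box a b) x *\<^sub>R (indicator B x *\<^sub>R (g x * indicator (cbox a b) x)))"
      by simp
    also have "(\<lambda>x. indicator (box a b) x *\<^sub>R (indicator B x *\<^sub>R (g x * indicator (cbox a b) x))) = (\<lambda>x. g x * indicator (box a b) x)"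
      using ab box_subset_cbox[of a b] by (auto simp: indicator_def fun_eq_iff)
    finally have int: "integrable lebesgue (\<lambda>x. g x * indicator (box a b) x)" .
    have "AE x in lebesgue. g x * indicator (box a b) x = 0"
    proof (rule integral_boxes_0_imp_AE_0[OF int])
      fix c d
      obtain p q where pq: "box a b \<inter> box c d = box p q" using box_Int_box by blast
      show "(LINT x|lebesgue. (g x * indicator (box a b) x) * indicator (box c d) x) = 0"
      \<comment> \<open>If the open box is empty, \<open>cbox p q\<close> can still be nonempty and
        stick out of \<open>cbox a b\<close>; otherwise it is the closure of the open box.\<close>
      proof (cases "box p q = {}")
        case True
        then show ?thesis unfolding eq pq by simp
      next
        case False
        then have "cbox p q = closure (box p q)" by (rule closure_box[symmetric])
        also have "\<dots> \<subseteq> cbox a b" using pq box_subset_cbox[of a b] by (intro closure_minimal closed_cbox) blast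
        finally show ?thesis
          unfolding eq pq using integral_box_eq_0(2)[OF g 0 _ Bl, of p q] ab by blast
      qed
    qed
    \<comment> \<open>The faces of a box are null, which passes from the open to the closed
      box.\<close>
    moreover have "AE x in lebesgue. x \<notin> cbox a b - box a b"
      using negligible_frontier_interval by (intro AE_not_in) (auto simp: negligible_iff_null_sets)
    ultimately show ?thesis by eventually_elim (auto simp: indicator_def split: if_splits)
  qed
  obtain D where D: "countable D" "D \<subseteq> Pow B" "\<And>X. X \<in> D \<Longrightarrow> \<exists>a b. X = cbox a b" "\<Union>D = B"
    by (rule open_countable_Union_open_cbox[OF B]) (rule that)
  have "AE x in lebesgue. \<forall>X\<in>D. x \<in> X \<longrightarrow> g x = 0"
  proof (subst AE_ball_countable[OF D(1)], intro ballI)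
    fix X assume "X \<in> D"
    with D obtain a b where "X = cbox a b" "cbox a b \<subseteq> B" by blast
    then show "AE x in lebesgue. x \<in> X \<longrightarrow> g x = 0" using local by simp
  qed
  then have "AE x in lebesgue. x \<in> B \<longrightarrow> g x = 0"
    by eventually_elim (use D(4) Union_iff in fastforce)
  then show ?thesis using Bl by (simp add: AE_restrict_space_iff)
qed

subsection \<open>Linearity of weak gradients and traces\<close>

lemma lin_subspace_lin:
  "lin_subspace V \<Longrightarrow> f \<in> V \<Longrightarrow> g \<in> V \<Longrightarrow> (\<lambda>x. a *\<^sub>R f x + b *\<^sub>R g x) \<in> V"
  by (simp add: lin_subspace_def)

lemma lin_subspaceI:
  assumes "(\<lambda>x. 0) \<in> V" "\<And>a f b g. f \<in> V \<Longrightarrow> g \<in> V \<Longrightarrow> (\<lambda>x. a *\<^sub>R f x + b *\<^sub>R g x) \<in> V"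
  shows "lin_subspace V"
  unfolding lin_subspace_def
proof (intro conjI ballI allI assms(1))
  fix f g c assume "f \<in> V" "g \<in> V"
  from assms(2)[OF this, of 1 1] show "(\<lambda>x. f x + g x) \<in> V" by simp
next
  fix f c assume f: "f \<in> V"
  from assms(2)[OF f f, of c 0] show "(\<lambda>x. c *\<^sub>R f x) \<in> V" by simp
qed

lemma lin_subspace_sum:
  assumes "lin_subspace V" "\<And>i. i \<in> I \<Longrightarrow> f i \<in> V"
  shows "(\<lambda>x. \<Sum>i\<in>I. c i *\<^sub>R f i x) \<in> V"
  using assms(2)
proof (induction I rule: infinite_finite_induct)
  case (insert i I)
  then show ?case using lin_subspace_lin[OF assms(1), of "f i" _ "c i" 1] by simp
qed (use assms(1) in \<open>auto simp: lin_subspace_def\<close>)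

lemma lin_subspace_Int: "lin_subspace V \<Longrightarrow> lin_subspace W \<Longrightarrow> lin_subspace (V \<inter> W)"
  by (simp add: lin_subspace_def)

lemma lin_subspace_vec_fields: "lin_subspace S \<Longrightarrow> lin_subspace (vec_fields S)"
  by (simp add: lin_subspace_def vec_fields_def)

section \<open>Weak derivatives up to null sets\<close>

lemma wpd_in_L2: "v \<in> H1 B \<Longrightarrow> wpd B j v \<in> L2 B"
  and weak_pd_wpd: "v \<in> H1 B \<Longrightarrow> weak_pd B j v (wpd B j v)"
proof -
  assume "v \<in> H1 B"
  then have "\<exists>g. g \<in> L2 B \<and> weak_pd B j v g" by (auto simp: H1_def)
  from someI_ex[OF this] show "wpd B j v \<in> L2 B" "weak_pd B j v (wpd B j v)"
    by (simp_all add: wpd_def)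
qed

lemma weak_pd_lin:
  assumes B: "open B" and lin: "ae_lin B a v b w u"
    and L2: "v \<in> L2 B" "w \<in> L2 B" "u \<in> L2 B" "g \<in> L2 B" "h \<in> L2 B"
    and wp: "weak_pd B j v g" "weak_pd B j w h"
  shows "weak_pd B j u (\<lambda>x. a *\<^sub>R g x + b *\<^sub>R h x)"
  unfolding weak_pd_def
proof (intro allI impI)
  fix \<phi> assume \<phi>: "test_fun B \<phi>"
  have t: "\<phi> \<in> L2 B" "pd j \<phi> \<in> L2 B" using test_fun_L2[OF \<phi>] B by auto
  have "ip B (\<lambda>x. a *\<^sub>R g x + b *\<^sub>R h x) \<phi> = a * ip B g \<phi> + b * ip B h \<phi>"
    by (intro ip_lin_left ae_linI ip_ok_L2 L2_lin L2 t refl)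
  also have "\<dots> = - (a * ip B v (pd j \<phi>) + b * ip B w (pd j \<phi>))"
    using wp \<phi> by (simp add: weak_pd_def)
  also have "a * ip B v (pd j \<phi>) + b * ip B w (pd j \<phi>) = ip B u (pd j \<phi>)"
    by (rule ip_lin_left[symmetric, OF lin]) (intro ip_ok_L2 L2 t)+
  finally show "ip B (\<lambda>x. a *\<^sub>R g x + b *\<^sub>R h x) \<phi> = - ip B u (pd j \<phi>)" .
qed

text \<open>The difference is orthogonal to every test function. This makes the choice in
  \<open>wpd\<close> harmless up to a null set.\<close>

lemma weak_pd_unique:
  assumes B: "open B" and L2: "g \<in> L2 B" "h \<in> L2 B" and wp: "weak_pd B j v g" "weak_pd B j v h"
  shows "AE x in lebesgue_on B. g x = h x"
proof -
  have "AE x in lebesgue_on B. 1 *\<^sub>R g x + (-1) *\<^sub>R h x = 0"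
  proof (rule test_fun_orthogonal_imp_AE_0[OF _ _ B])
    fix \<phi> assume \<phi>: "test_fun B \<phi>"
    have t: "\<phi> \<in> L2 B" using test_fun_L2[OF \<phi>] B by auto
    have "ip B (\<lambda>x. 1 *\<^sub>R g x + (-1) *\<^sub>R h x) \<phi> = 1 * ip B g \<phi> + (-1) * ip B h \<phi>"
      by (intro ip_lin_left ae_linI ip_ok_L2 L2_lin L2 t refl)
    then show "ip B (\<lambda>x. 1 *\<^sub>R g x + (-1) *\<^sub>R h x) \<phi> = 0"
      using wp \<phi> by (simp add: weak_pd_def)
  qed (intro L2_lin L2)
  then show ?thesis by eventually_elim simp
qed

lemma H1_imp_L2: "v \<in> H1 B \<Longrightarrow> v \<in> L2 B"
  by (simp add: H1_def)

lemma H1_lin: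
  assumes "open B" "v \<in> H1 B" "w \<in> H1 B"
  shows "(\<lambda>x. a *\<^sub>R v x + b *\<^sub>R w x) \<in> H1 B"
proof -
  have L2: "v \<in> L2 B" "w \<in> L2 B" "(\<lambda>x. a *\<^sub>R v x + b *\<^sub>R w x) \<in> L2 B"
    using assms H1_imp_L2 L2_lin by blast+
  have "weak_pd B j (\<lambda>x. a *\<^sub>R v x + b *\<^sub>R w x) (\<lambda>x. a *\<^sub>R wpd B j v x + b *\<^sub>R wpd B j w x)" for j
    by (rule weak_pd_lin[OF assms(1) ae_linI L2 wpd_in_L2[OF assms(2)] wpd_in_L2[OF assms(3)]
          weak_pd_wpd[OF assms(2)] weak_pd_wpd[OF assms(3)]]) (rule refl)
  moreover have "(\<lambda>x. a *\<^sub>R wpd B j v x + b *\<^sub>R wpd B j w x) \<in> L2 B" for j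
    by (intro L2_lin wpd_in_L2 assms)
  ultimately show ?thesis
    using L2(3) unfolding H1_def mem_Collect_eq by (intro conjI allI bexI)
qed

text \<open>The combination of the chosen derivatives is some weak derivative of \<open>u\<close>,
  hence almost everywhere the chosen one.\<close>

lemma wpd_lin:
  assumes "open B" "ae_lin B a v b w u" "v \<in> H1 B" "w \<in> H1 B" "u \<in> H1 B"
  shows "ae_lin B a (wpd B j v) b (wpd B j w) (wpd B j u)"
proof -
  have "weak_pd B j u (\<lambda>x. a *\<^sub>R wpd B j v x + b *\<^sub>R wpd B j w x)"
    by (intro weak_pd_lin[OF assms(1,2)] H1_imp_L2 wpd_in_L2 weak_pd_wpd assms)
  from weak_pd_unique[OF assms(1) wpd_in_L2[OF assms(5)] L2_lin[OF wpd_in_L2 wpd_in_L2] weak_pd_wpd[OF assms(5)] this]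
  show ?thesis using assms by (simp add: ae_lin_def)
qed

lemma grad_lin:
  assumes "open B" "ae_lin B a V b W U"
    and "V \<in> vec_fields (H1 B)" "W \<in> vec_fields (H1 B)" "U \<in> vec_fields (H1 B)"
  shows "ae_lin B a (grad B V) b (grad B W) (grad B U)"
proof -
  have "ae_lin B a (\<lambda>x. V x $ I) b (\<lambda>x. W x $ I) (\<lambda>x. U x $ I)" for I
    using assms(2) by (rule ae_lin_map) (auto intro!: linearI)
  then have "ae_lin B a (wpd B J (\<lambda>x. V x $ I)) b (wpd B J (\<lambda>x. W x $ I)) (wpd B J (\<lambda>x. U x $ I))" for I J
    using assms by (intro wpd_lin) (auto simp: vec_fields_def)
  \<comment> \<open>Finitely many components, so their exceptional null sets can be merged.\<close>
  then have "AE x in lebesgue_on B. \<forall>I J. wpd B J (\<lambda>x. U x $ I) x =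
      a *\<^sub>R wpd B J (\<lambda>x. V x $ I) x + b *\<^sub>R wpd B J (\<lambda>x. W x $ I) x"
    unfolding ae_lin_def by (intro eventually_all_finite)
  then show ?thesis
    unfolding ae_lin_def by eventually_elim (simp add: grad_def vec_eq_iff)
qed

section \<open>The H1 norm and boundary traces\<close>

lemma H1_norm_sq: "(H1_norm B v)\<^sup>2 =
    (l2_norm (lebesgue_on B) v)\<^sup>2 + (\<Sum>j\<in>UNIV. (l2_norm (lebesgue_on B) (wpd B j v))\<^sup>2)"
  unfolding H1_norm_def by (intro real_sqrt_pow2 add_nonneg_nonneg sum_nonneg zero_le_power2)

lemma H1_norm_lin_le:
  assumes "open B" "ae_lin B a v b w u" "v \<in> H1 B" "w \<in> H1 B" "u \<in> H1 B"
  shows "(H1_norm B u)\<^sup>2 \<le> 2 * a\<^sup>2 * (H1_norm B v)\<^sup>2 + 2 * b\<^sup>2 * (H1_norm B w)\<^sup>2"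
proof -
  let ?N = "\<lambda>v. (l2_norm (lebesgue_on B) v)\<^sup>2"
  have le: "?N u \<le> 2 * a\<^sup>2 * ?N v + 2 * b\<^sup>2 * ?N w"
    using assms(3-5)[THEN H1_imp_L2] assms(2) unfolding ae_lin_def L2_def mem_Collect_eq by (rule l2_norm_lin_le)
  have "?N (wpd B j u) \<le> 2 * a\<^sup>2 * ?N (wpd B j v) + 2 * b\<^sup>2 * ?N (wpd B j w)" for j
    using assms(3-5)[THEN wpd_in_L2, of j] wpd_lin[OF assms, of j]
    unfolding ae_lin_def L2_def mem_Collect_eq by (rule l2_norm_lin_le)
  then have "(\<Sum>j\<in>UNIV. ?N (wpd B j u)) \<le> (\<Sum>j\<in>UNIV. 2 * a\<^sup>2 * ?N (wpd B j v) + 2 * b\<^sup>2 * ?N (wpd B j w))"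
    by (intro sum_mono)
  also have "\<dots> = 2 * a\<^sup>2 * (\<Sum>j\<in>UNIV. ?N (wpd B j v)) + 2 * b\<^sup>2 * (\<Sum>j\<in>UNIV. ?N (wpd B j w))"
    by (simp only: sum.distrib sum_distrib_left)
  finally show ?thesis
    using le unfolding H1_norm_sq distrib_left by linarith
qed

lemma tendsto_0_lin_squares:
  fixes f g h :: "nat \<Rightarrow> real"
  assumes "f \<longlonglongrightarrow> 0" "g \<longlonglongrightarrow> 0" "\<And>k. (h k)\<^sup>2 \<le> 2 * a\<^sup>2 * (f k)\<^sup>2 + 2 * b\<^sup>2 * (g k)\<^sup>2"
  shows "h \<longlonglongrightarrow> 0"
proof -
  have "(\<lambda>k. 2 * a\<^sup>2 * (f k)\<^sup>2 + 2 * b\<^sup>2 * (g k)\<^sup>2) \<longlonglongrightarrow> 2 * a\<^sup>2 * 0\<^sup>2 + 2 * b\<^sup>2 * 0\<^sup>2"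
    by (rule tendsto_add[OF tendsto_mult[OF tendsto_const tendsto_power[OF assms(1)]]
          tendsto_mult[OF tendsto_const tendsto_power[OF assms(2)]]])
  then have lim: "(\<lambda>k. sqrt (2 * a\<^sup>2 * (f k)\<^sup>2 + 2 * b\<^sup>2 * (g k)\<^sup>2)) \<longlonglongrightarrow> 0"
    by (auto dest: tendsto_real_sqrt)
  have "norm (h k) \<le> sqrt (2 * a\<^sup>2 * (f k)\<^sup>2 + 2 * b\<^sup>2 * (g k)\<^sup>2)" for k
    using real_sqrt_le_mono[OF assms(3)[of k]] by simp
  then show ?thesis
    by (rule Lim_null_comparison[OF always_eventually[OF allI] lim])
qed

text \<open>The approximating sequences are combined with the same coefficients; both errors are
  controlled by the bounds on squares.\<close>

lemma has_trace_lin: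
  assumes B: "open B" and "has_trace B v g" "has_trace B w h"
  shows "has_trace B (\<lambda>x. a *\<^sub>R v x + b *\<^sub>R w x) (\<lambda>x. a *\<^sub>R g x + b *\<^sub>R h x)"
proof -
  let ?S = "surface_measure (frontier B)"
  have H1: "v \<in> H1 B" "w \<in> H1 B" using assms by (auto simp: has_trace_def)
  obtain \<phi> where \<phi>: "\<And>k. smooth (\<phi> k)" "\<And>k. \<phi> k \<in> H1 B" "\<And>k. sq_int ?S (\<lambda>x. \<phi> k x - g x)"
      "(\<lambda>k. H1_norm B (\<lambda>x. \<phi> k x - v x)) \<longlonglongrightarrow> 0" "(\<lambda>k. l2_norm ?S (\<lambda>x. \<phi> k x - g x)) \<longlonglongrightarrow> 0"
    using assms(2) unfolding has_trace_def by (elim conjE exE) (rule that, auto)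
  obtain \<psi> where \<psi>: "\<And>k. smooth (\<psi> k)" "\<And>k. \<psi> k \<in> H1 B" "\<And>k. sq_int ?S (\<lambda>x. \<psi> k x - h x)"
      "(\<lambda>k. H1_norm B (\<lambda>x. \<psi> k x - w x)) \<longlonglongrightarrow> 0" "(\<lambda>k. l2_norm ?S (\<lambda>x. \<psi> k x - h x)) \<longlonglongrightarrow> 0"
    using assms(3) unfolding has_trace_def by (elim conjE exE) (rule that, auto)
  define \<theta> where "\<theta> k x = a *\<^sub>R \<phi> k x + b *\<^sub>R \<psi> k x" for k x
  have diff: "\<theta> k x - (a *\<^sub>R p + b *\<^sub>R q) = a *\<^sub>R (\<phi> k x - p) + b *\<^sub>R (\<psi> k x - q)" for k x p q
    by (simp add: \<theta>_def algebra_simps)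
  have dv: "(\<lambda>x. \<phi> k x - v x) \<in> H1 B" and dw: "(\<lambda>x. \<psi> k x - w x) \<in> H1 B" for k
    using H1_lin[OF B \<phi>(2) H1(1), of 1 k "-1"] H1_lin[OF B \<psi>(2) H1(2), of 1 k "-1"] by simp_all
  show ?thesis
    unfolding has_trace_def
  proof (intro conjI exI[of _ \<theta>] allI)
    show "(\<lambda>x. a *\<^sub>R v x + b *\<^sub>R w x) \<in> H1 B" by (rule H1_lin[OF B H1])
    show "smooth (\<theta> k)" for k
      unfolding \<theta>_def[abs_def] real_scaleR_def by (intro smooth_add smooth_mult smooth_const \<phi> \<psi>)
    show "\<theta> k \<in> H1 B" for k
      unfolding \<theta>_def[abs_def] by (rule H1_lin[OF B \<phi>(2) \<psi>(2)])
    show "sq_int ?S (\<lambda>x. \<theta> k x - (a *\<^sub>R g x + b *\<^sub>R h x))" for k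
      unfolding diff by (rule sq_int_lin[OF \<phi>(3) \<psi>(3)])
    show "(\<lambda>k. H1_norm B (\<lambda>x. \<theta> k x - (a *\<^sub>R v x + b *\<^sub>R w x))) \<longlonglongrightarrow> 0"
      unfolding diff
      by (rule tendsto_0_lin_squares[OF \<phi>(4) \<psi>(4)])
        (rule H1_norm_lin_le[OF B ae_linI[OF refl] dv dw H1_lin[OF B dv dw]])
    show "(\<lambda>k. l2_norm ?S (\<lambda>x. \<theta> k x - (a *\<^sub>R g x + b *\<^sub>R h x))) \<longlonglongrightarrow> 0"
      unfolding diff
      by (rule tendsto_0_lin_squares[OF \<phi>(5) \<psi>(5)])
        (rule l2_norm_lin_le[OF \<phi>(3) \<psi>(3) sq_int_lin[OF \<phi>(3) \<psi>(3)] AE_I2[OF refl]])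
  qed
qed

lemma zero_in_H1: "(\<lambda>x. 0) \<in> H1 B"
proof -
  have "(\<lambda>x. 0::real) \<in> L2 B" by (simp add: L2_def sq_int_def)
  moreover have "weak_pd B j (\<lambda>x. 0) (\<lambda>x. 0)" for j by (simp add: weak_pd_def ip_def)
  ultimately show ?thesis unfolding H1_def by blast
qed

text \<open>The chosen weak derivative of 0 is 0 only almost everywhere; the estimate with both
  coefficients 0 absorbs this.\<close>

lemma H1_norm_zero:
  assumes "open B"
  shows "H1_norm B (\<lambda>x. 0) = 0"
  using H1_norm_lin_le[OF assms, of 0 "\<lambda>x. 0" 0 "\<lambda>x. 0" "\<lambda>x. 0"] zero_in_H1[of B]
  by (simp add: ae_lin_def)

lemma has_trace_zero: "open B \<Longrightarrow> has_trace B (\<lambda>x. 0) (\<lambda>x. 0)"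
  unfolding has_trace_def
  by (intro conjI zero_in_H1 exI[of _ "\<lambda>k x. 0"])
     (simp_all add: zero_in_H1 H1_norm_zero sq_int_def l2_norm_def)

lemma lin_subspace_H1_van:
  assumes "open B"
  shows "lin_subspace (H1_van B \<Gamma>)"
proof (rule lin_subspaceI)
  show "(\<lambda>x. 0) \<in> H1_van B \<Gamma>"
    using has_trace_zero[OF assms] zero_in_H1 by (auto simp: H1_van_def eq_on_boundary_def)
next
  fix a b and f g :: "(real, 'a) vec \<Rightarrow> real"
  assume "f \<in> H1_van B \<Gamma>" "g \<in> H1_van B \<Gamma>"
  then obtain f' g' where *: "has_trace B f f'" "has_trace B g g'"
      "AE x in surface_measure (frontier B). x \<in> \<Gamma> \<longrightarrow> f' x = 0"
      "AE x in surface_measure (frontier B). x \<in> \<Gamma> \<longrightarrow> g' x = 0" "f \<in> H1 B" "g \<in> H1 B"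
    by (auto simp: H1_van_def eq_on_boundary_def)
  from *(3,4) have "AE x in surface_measure (frontier B). x \<in> \<Gamma> \<longrightarrow> a *\<^sub>R f' x + b *\<^sub>R g' x = 0"
    by eventually_elim simp
  then show "(\<lambda>x. a *\<^sub>R f x + b *\<^sub>R g x) \<in> H1_van B \<Gamma>"
    unfolding H1_van_def eq_on_boundary_def mem_Collect_eq
    by (intro conjI H1_lin[OF assms *(5,6)] exI[of _ "\<lambda>x. a *\<^sub>R f' x + b *\<^sub>R g' x"] has_trace_lin[OF assms *(1,2)])
qed

subsection \<open>Singular matrices\<close>

text \<open>Gaussian elimination, one equation at a time. General index sets allow blocks to be
  selected without renumbering.\<close>

lemma underdetermined_system_nonzero_solution:
  fixes A :: "'i \<Rightarrow> 'j \<Rightarrow> 'a::field"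
  assumes "finite S" "finite J" "card S < card J"
  shows "\<exists>d. (\<exists>j\<in>J. d j \<noteq> 0) \<and> (\<forall>i\<in>S. (\<Sum>j\<in>J. A i j * d j) = 0)"
  using assms
proof (induction S arbitrary: A J rule: finite_induct)
  case empty
  then have "J \<noteq> {}" by auto
  then show ?case by (intro exI[of _ "\<lambda>_. 1"]) auto
next
  case (insert s S)
  show ?case
  proof (cases "\<forall>j\<in>J. A s j = 0")
    case True
    obtain d where "\<exists>j\<in>J. d j \<noteq> 0" "\<forall>i\<in>S. (\<Sum>j\<in>J. A i j * d j) = 0"
      using insert.IH[of J A] insert.prems insert.hyps by auto
    then show ?thesis using True by (intro exI[of _ d]) auto
  next
    case False
    then obtain j0 where j0: "j0 \<in> J" "A s j0 \<noteq> 0" by blast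
    \<comment> \<open>Equation \<open>s\<close> is solved for the unknown \<open>j0\<close> and
      substituted into the others; \<open>x\<close> below is the back substitution.\<close>
    define A' where "A' i j = A i j - A i j0 * A s j / A s j0" for i j
    have "card S < card (J - {j0})"
      using insert.prems insert.hyps j0(1) by (simp add: card_Diff_singleton)
    then obtain d where d: "\<exists>j\<in>J - {j0}. d j \<noteq> 0" "\<forall>i\<in>S. (\<Sum>j\<in>J - {j0}. A' i j * d j) = 0"
      using insert.IH[of "J - {j0}" A'] insert.prems by blast
    define x where "x = - (\<Sum>j\<in>J - {j0}. A s j * d j) / A s j0"
    have sum: "(\<Sum>j\<in>J. A i j * (d(j0 := x)) j) = A i j0 * x + (\<Sum>j\<in>J - {j0}. A i j * d j)" for i
      using insert.prems j0(1) by (subst sum.remove[of J j0]) (auto intro!: sum.cong)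
    have "(\<Sum>j\<in>J. A s j * (d(j0 := x)) j) = 0"
      using j0 by (simp only: sum) (simp add: x_def)
    moreover have "(\<Sum>j\<in>J. A i j * (d(j0 := x)) j) = 0" if "i \<in> S" for i
    proof -
      have "0 = (\<Sum>j\<in>J - {j0}. A i j * d j - A i j0 / A s j0 * (A s j * d j))"
        using d(2) that by (simp add: A'_def algebra_simps)
      also have "\<dots> = (\<Sum>j\<in>J - {j0}. A i j * d j) + A i j0 * x"
        by (simp add: sum_subtractf sum_distrib_left sum_divide_distrib x_def)
      finally show ?thesis by (simp only: sum add.commute)
    qed
    moreover have "\<exists>j\<in>J. (d(j0 := x)) j \<noteq> 0" using d(1) by auto
    ultimately show ?thesis by blast
  qed
qed

text \<open>Drop one of the transposed equations, at an index where \<open>d\<close> is nonzero; the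
  rest is underdetermined. The dropped equation then holds as well, because the sum of all of them
  weighted by \<open>d\<close> is 0.\<close>

lemma square_singular_transpose:
  fixes A :: "'i \<Rightarrow> 'i \<Rightarrow> 'a::field"
  assumes "finite I" "\<exists>j\<in>I. d j \<noteq> 0" "\<forall>i\<in>I. (\<Sum>j\<in>I. A i j * d j) = 0"
  shows "\<exists>c. (\<exists>i\<in>I. c i \<noteq> 0) \<and> (\<forall>j\<in>I. (\<Sum>i\<in>I. c i * A i j) = 0)"
proof -
  obtain j0 where j0: "j0 \<in> I" "d j0 \<noteq> 0" using assms(2) by blast
  have "card (I - {j0}) < card I" using assms(1) j0(1) by (metis card_Diff1_less)
  then obtain c where c: "\<exists>i\<in>I. c i \<noteq> 0" "\<forall>j\<in>I - {j0}. (\<Sum>i\<in>I. A i j * c i) = 0"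
    using underdetermined_system_nonzero_solution[of "I - {j0}" I "\<lambda>j i. A i j"] assms(1) by auto
  have "d j0 * (\<Sum>i\<in>I. A i j0 * c i) = (\<Sum>j\<in>I. d j * (\<Sum>i\<in>I. A i j * c i))"
    using assms(1) j0(1) c(2) by (subst sum.remove[of I j0]) auto
  also have "\<dots> = (\<Sum>j\<in>I. \<Sum>i\<in>I. c i * (A i j * d j))"
    by (simp add: sum_distrib_left mult_ac)
  also have "\<dots> = (\<Sum>i\<in>I. \<Sum>j\<in>I. c i * (A i j * d j))"
    by (rule sum.swap)
  also have "\<dots> = (\<Sum>i\<in>I. c i * (\<Sum>j\<in>I. A i j * d j))"
    by (simp add: sum_distrib_left)
  also have "\<dots> = 0" using assms(3) by simp
  finally have "(\<Sum>i\<in>I. A i j0 * c i) = 0" using j0(2) by simp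
  with c show ?thesis by (intro exI[of _ c]) (auto simp: mult.commute[of "c _"])
qed

text \<open>The columns in \<open>J\<close> are supported on the rows in \<open>S\<close>, which are
  too few, so these columns are dependent; squareness then makes the rows dependent.\<close>

lemma zero_block_imp_kernels:
  fixes A :: "'i \<Rightarrow> 'i \<Rightarrow> 'a::field"
  assumes I: "finite I" and "S \<subseteq> I" "J \<subseteq> I" "card S < card J"
    and 0: "\<And>i j. i \<in> I - S \<Longrightarrow> j \<in> J \<Longrightarrow> A i j = 0"
  shows "\<exists>d. (\<exists>j\<in>I. d j \<noteq> 0) \<and> (\<forall>i\<in>I. (\<Sum>j\<in>I. A i j * d j) = 0)"
    and "\<exists>c. (\<exists>i\<in>I. c i \<noteq> 0) \<and> (\<forall>j\<in>I. (\<Sum>i\<in>I. c i * A i j) = 0)"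
proof -
  have fin: "finite S" "finite J" using assms finite_subset by auto
  obtain d where d: "\<exists>j\<in>J. d j \<noteq> 0" "\<forall>i\<in>S. (\<Sum>j\<in>J. A i j * d j) = 0"
    using underdetermined_system_nonzero_solution[OF fin assms(4)] by blast
  define d' where "d' j = (if j \<in> J then d j else 0)" for j
  have "(\<Sum>j\<in>I. A i j * d' j) = 0" if "i \<in> I" for i
  proof -
    have "(\<Sum>j\<in>I. A i j * d' j) = (\<Sum>j\<in>J. A i j * d j)"
      using I assms(3) by (intro sum.mono_neutral_cong_right) (auto simp: d'_def)
    also have "\<dots> = 0"
      using that d(2) 0 by (cases "i \<in> S") auto
    finally show ?thesis .
  qed
  moreover have "\<exists>j\<in>I. d' j \<noteq> 0" using d(1) assms(3) by (auto simp: d'_def)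
  ultimately have *: "(\<exists>j\<in>I. d' j \<noteq> 0) \<and> (\<forall>i\<in>I. (\<Sum>j\<in>I. A i j * d' j) = 0)" by blast
  then show "\<exists>d. (\<exists>j\<in>I. d j \<noteq> 0) \<and> (\<forall>i\<in>I. (\<Sum>j\<in>I. A i j * d j) = 0)" by blast
  show "\<exists>c. (\<exists>i\<in>I. c i \<noteq> 0) \<and> (\<forall>j\<in>I. (\<Sum>i\<in>I. c i * A i j) = 0)"
    using square_singular_transpose[OF I] * by blast
qed

subsection \<open>Bilinearity of the linearized form\<close>

fun Z_lin :: "'n region \<Rightarrow> real \<Rightarrow> 'n::finite fields \<Rightarrow> real \<Rightarrow> 'n fields \<Rightarrow> 'n fields \<Rightarrow> bool" where
  "Z_lin B a (V, M, Q, r) b (V', M', Q', r') (V'', M'', Q'', r'') \<longleftrightarrow>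
     ae_lin B a V b V' V'' \<and> ae_lin B a M b M' M'' \<and> ae_lin B a Q b Q' Q'' \<and> ae_lin B a r b r' r''"

text \<open>Coefficients 1 and 0 give independence of the representative, so this is linearity on
  classes modulo null functions.\<close>

definition Z_linear_on :: "'n region \<Rightarrow> 'n::finite fields set \<Rightarrow> ('n fields \<Rightarrow> real) \<Rightarrow> bool" where
  "Z_linear_on B Zh L \<longleftrightarrow> (\<forall>z\<in>Zh. \<forall>z'\<in>Zh. \<forall>z''\<in>Zh. \<forall>a b.
     Z_lin B a z b z' z'' \<longrightarrow> L z'' = a * L z + b * L z')"

lemma Z_linear_onD:
  "Z_linear_on B Zh L \<Longrightarrow> z \<in> Zh \<Longrightarrow> z' \<in> Zh \<Longrightarrow> z'' \<in> Zh \<Longrightarrow> Z_lin B a z b z' z'' \<Longrightarrow>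
     L z'' = a * L z + b * L z'"
  unfolding Z_linear_on_def by blast

lemma linear_elast_app: "linear (elast_app \<P> K)"
  by (intro linearI)
     (simp_all add: elast_app_def vec_eq_iff sum.distrib sum_distrib_left distrib_left mult_ac)

lemma linear_mult_transpose_mult: "linear (\<lambda>M. c *\<^sub>R (X ** transpose M ** Y))"
  for X Y :: "real^'n^'n"
  by (intro linearI)
     (simp_all add: matrix_matrix_mult_def transpose_def vec_eq_iff sum.distrib sum_distrib_left
       distrib_left distrib_right mult_ac)

lemma linear_trace_mult: "linear (\<lambda>M. c * trace (X ** M))"
  for X :: "real^'n^'n"
  by (intro linearI)
     (simp_all add: trace_def matrix_matrix_mult_def sum.distrib sum_distrib_left distrib_left mult_ac)

lemma bform_linear_left:
  assumes B: "open B" and Zh: "Zh \<subseteq> vec_fields (H1 B) \<times> UNIV"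
    and ok: "\<And>z. z \<in> Zh \<Longrightarrow> bform_ok B \<P> w z y"
  shows "Z_linear_on B Zh (\<lambda>z. bform B \<P> w z y)"
  unfolding Z_linear_on_def
proof (intro ballI allI impI)
  fix z z' z'' a b
  assume Z: "z \<in> Zh" "z' \<in> Zh" "z'' \<in> Zh" and lin: "Z_lin B a z b z' z''"
  obtain U K P p where w: "w = (U, K, P, p)" by (cases w)
  obtain \<Upsilon> \<Lambda> \<pi> q where y: "y = (\<Upsilon>, \<Lambda>, \<pi>, q)" by (cases y)
  obtain V M Q r where z: "z = (V, M, Q, r)" by (cases z)
  obtain V' M' Q' r' where z': "z' = (V', M', Q', r')" by (cases z')
  obtain V'' M'' Q'' r'' where z'': "z'' = (V'', M'', Q'', r'')" by (cases z'')
  have l: "ae_lin B a V b V' V''" "ae_lin B a M b M' M''" "ae_lin B a Q b Q' Q''" "ae_lin B a r b r' r''"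
    using lin by (simp_all add: z z' z'')
  have H1: "V \<in> vec_fields (H1 B)" "V' \<in> vec_fields (H1 B)" "V'' \<in> vec_fields (H1 B)"
    using Z Zh by (auto simp: z z' z'')
  note oks = ok[OF Z(1), unfolded z w y bform_ok.simps] ok[OF Z(2), unfolded z' w y bform_ok.simps]
    ok[OF Z(3), unfolded z'' w y bform_ok.simps]
  have "ip B Q'' (grad B \<Upsilon>) = a * ip B Q (grad B \<Upsilon>) + b * ip B Q' (grad B \<Upsilon>)"
    by (rule ip_lin_left[OF l(3)]) (use oks in blast)+
  moreover have "ip B (grad B V'') \<Lambda> = a * ip B (grad B V) \<Lambda> + b * ip B (grad B V') \<Lambda>"
    by (rule ip_lin_left[OF grad_lin[OF B l(1) H1]]) (use oks in blast)+
  moreover have "ip B M'' \<Lambda> = a * ip B M \<Lambda> + b * ip B M' \<Lambda>"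
    by (rule ip_lin_left[OF l(2)]) (use oks in blast)+
  moreover have "ip B (\<lambda>x. elast_app \<P> (K x) (M'' x)) \<pi> =
      a * ip B (\<lambda>x. elast_app \<P> (K x) (M x)) \<pi> + b * ip B (\<lambda>x. elast_app \<P> (K x) (M' x)) \<pi>"
    by (rule ip_lin_left[OF ae_lin_map[OF l(2) linear_elast_app]]) (use oks in blast)+
  moreover have "ip B Q'' \<pi> = a * ip B Q \<pi> + b * ip B Q' \<pi>"
    by (rule ip_lin_left[OF l(3)]) (use oks in blast)+
  moreover have "ip B (\<lambda>x. p x *\<^sub>R (FinvT (K x) ** transpose (M'' x) ** FinvT (K x))) \<pi> =
      a * ip B (\<lambda>x. p x *\<^sub>R (FinvT (K x) ** transpose (M x) ** FinvT (K x))) \<pi> +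
      b * ip B (\<lambda>x. p x *\<^sub>R (FinvT (K x) ** transpose (M' x) ** FinvT (K x))) \<pi>"
    by (rule ip_lin_left[OF ae_lin_map[OF l(2) linear_mult_transpose_mult]]) (use oks in blast)+
  moreover have "ip B (\<lambda>x. r'' x *\<^sub>R FinvT (K x)) \<pi> =
      a * ip B (\<lambda>x. r x *\<^sub>R FinvT (K x)) \<pi> + b * ip B (\<lambda>x. r' x *\<^sub>R FinvT (K x)) \<pi>"
    by (rule ip_lin_left[OF ae_lin_map[OF l(4) linear_scaleR_left]]) (use oks in blast)+
  moreover have "ip B (\<lambda>x. det (mat 1 + K x) * trace (matrix_inv (mat 1 + K x) ** M'' x)) q =
      a * ip B (\<lambda>x. det (mat 1 + K x) * trace (matrix_inv (mat 1 + K x) ** M x)) q +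
      b * ip B (\<lambda>x. det (mat 1 + K x) * trace (matrix_inv (mat 1 + K x) ** M' x)) q"
    by (rule ip_lin_left[OF ae_lin_map[OF l(2) linear_trace_mult]]) (use oks in blast)+
  ultimately show "bform B \<P> w z'' y = a * bform B \<P> w z y + b * bform B \<P> w z' y"
    unfolding w y z z' z'' bform.simps by (simp only:) (simp add: algebra_simps)
qed

lemma bform_linear_right:
  assumes B: "open B" and Zh: "Zh \<subseteq> vec_fields (H1 B) \<times> UNIV"
    and ok: "\<And>y. y \<in> Zh \<Longrightarrow> bform_ok B \<P> w z y"
  shows "Z_linear_on B Zh (bform B \<P> w z)"
  unfolding Z_linear_on_def
proof (intro ballI allI impI)
  fix y y' y'' a b
  assume Z: "y \<in> Zh" "y' \<in> Zh" "y'' \<in> Zh" and lin: "Z_lin B a y b y' y''"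
  obtain U K P p where w: "w = (U, K, P, p)" by (cases w)
  obtain V M Q r where z: "z = (V, M, Q, r)" by (cases z)
  obtain \<Upsilon> \<Lambda> \<pi> q where y: "y = (\<Upsilon>, \<Lambda>, \<pi>, q)" by (cases y)
  obtain \<Upsilon>' \<Lambda>' \<pi>' q' where y': "y' = (\<Upsilon>', \<Lambda>', \<pi>', q')" by (cases y')
  obtain \<Upsilon>'' \<Lambda>'' \<pi>'' q'' where y'': "y'' = (\<Upsilon>'', \<Lambda>'', \<pi>'', q'')" by (cases y'')
  have l: "ae_lin B a \<Upsilon> b \<Upsilon>' \<Upsilon>''" "ae_lin B a \<Lambda> b \<Lambda>' \<Lambda>''" "ae_lin B a \<pi> b \<pi>' \<pi>''" "ae_lin B a q b q' q''"
    using lin by (simp_all add: y y' y'')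
  have H1: "\<Upsilon> \<in> vec_fields (H1 B)" "\<Upsilon>' \<in> vec_fields (H1 B)" "\<Upsilon>'' \<in> vec_fields (H1 B)"
    using Z Zh by (auto simp: y y' y'')
  note oks = ok[OF Z(1), unfolded y w z bform_ok.simps] ok[OF Z(2), unfolded y' w z bform_ok.simps]
    ok[OF Z(3), unfolded y'' w z bform_ok.simps]
  have G: "ip B X (grad B \<Upsilon>'') = a * ip B X (grad B \<Upsilon>) + b * ip B X (grad B \<Upsilon>')"
    if "ip_ok B X (grad B \<Upsilon>)" "ip_ok B X (grad B \<Upsilon>')" "ip_ok B X (grad B \<Upsilon>'')" for X
    using grad_lin[OF B l(1) H1] that by (rule ip_lin_right)
  note L = ip_lin_right[OF l(2)] and P = ip_lin_right[OF l(3)] and q = ip_lin_right[OF l(4)]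
  show "bform B \<P> w z y'' = a * bform B \<P> w z y + b * bform B \<P> w z y'"
    using oks unfolding w z y y' y'' bform.simps
    by (simp add: G L P q algebra_simps)
qed

section \<open>Functionals on finite combinations\<close>

definition Z_sum :: "'i set \<Rightarrow> ('i \<Rightarrow> real) \<Rightarrow> ('i \<Rightarrow> 'n::finite fields) \<Rightarrow> 'n fields" where
  "Z_sum I c E = (\<lambda>x. \<Sum>i\<in>I. c i *\<^sub>R fst (E i) x, \<lambda>x. \<Sum>i\<in>I. c i *\<^sub>R fst (snd (E i)) x,
     \<lambda>x. \<Sum>i\<in>I. c i *\<^sub>R fst (snd (snd (E i))) x, \<lambda>x. \<Sum>i\<in>I. c i *\<^sub>R snd (snd (snd (E i))) x)"

lemma Z_sum_mem:
  assumes "lin_subspace W1" "lin_subspace W2" "lin_subspace W3" "lin_subspace W4"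
    and "\<And>i. i \<in> I \<Longrightarrow> E i \<in> W1 \<times> W2 \<times> W3 \<times> W4"
  shows "Z_sum I c E \<in> W1 \<times> W2 \<times> W3 \<times> W4"
proof -
  have "fst (E i) \<in> W1" "fst (snd (E i)) \<in> W2" "fst (snd (snd (E i))) \<in> W3" "snd (snd (snd (E i))) \<in> W4"
    if "i \<in> I" for i
    using assms(5)[OF that] by auto
  then show ?thesis
    unfolding Z_sum_def by (intro SigmaI lin_subspace_sum assms(1-4))
qed

lemma Z_linear_on_Z_sum:
  assumes W: "lin_subspace W1" "lin_subspace W2" "lin_subspace W3" "lin_subspace W4"
    and L: "Z_linear_on B (W1 \<times> W2 \<times> W3 \<times> W4) L"
    and "finite I" "\<And>i. i \<in> I \<Longrightarrow> E i \<in> W1 \<times> W2 \<times> W3 \<times> W4"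
  shows "L (Z_sum I c E) = (\<Sum>i\<in>I. c i * L (E i))"
  using assms(6,7)
proof (induction I rule: finite_induct)
  case empty
  have mem: "Z_sum {} c E \<in> W1 \<times> W2 \<times> W3 \<times> W4" by (rule Z_sum_mem[OF W]) simp
  \<comment> \<open>The empty sum is the combination of itself with coefficients 0 and 0, so
    \<open>L\<close> maps it to 0.\<close>
  have "Z_lin B 0 (Z_sum {} c E) 0 (Z_sum {} c E) (Z_sum {} c E)"
    by (simp add: Z_sum_def ae_lin_def)
  from Z_linear_onD[OF L mem mem mem this] show ?case by simp
next
  case (insert i I)
  have mem: "Z_sum J c E \<in> W1 \<times> W2 \<times> W3 \<times> W4" if "J \<subseteq> insert i I" for J
    by (rule Z_sum_mem[OF W]) (use insert.prems that in blast)
  have "Z_lin B (c i) (E i) 1 (Z_sum I c E) (Z_sum (insert i I) c E)"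
    by (cases "E i") (use insert.hyps in \<open>simp add: Z_sum_def ae_lin_def\<close>)
  from Z_linear_onD[OF L insert.prems[of i] mem mem this]
  have "L (Z_sum (insert i I) c E) = c i * L (E i) + 1 * L (Z_sum I c E)" by blast
  then show ?case using insert by simp
qed

subsection \<open>Kernels of the discrete linearization\<close>

text \<open>Slots 0 to 3 are displacement, displacement gradient, stress and pressure; the other
  components vanish literally, not just almost everywhere.\<close>

fun slot :: "nat \<Rightarrow> 'n::finite fields \<Rightarrow> bool" where
  "slot k (V, M, Q, r) \<longleftrightarrow> (k \<noteq> 0 \<longrightarrow> V = (\<lambda>x. 0)) \<and> (k \<noteq> 1 \<longrightarrow> M = (\<lambda>x. 0)) \<and>
     (k \<noteq> 2 \<longrightarrow> Q = (\<lambda>x. 0)) \<and> (k \<noteq> 3 \<longrightarrow> r = (\<lambda>x. 0))"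

text \<open>The four bases are concatenated, with the first index recording the slot. Spanning is
  phrased as a combination with coefficients 1 and 0, the form to which \<open>Z_linear_onD\<close>
  applies.\<close>

lemma product_basis:
  fixes W1 :: "'n::finite vfield set" and W2 W3 :: "'n tfield set" and W4 :: "'n sfield set"
  assumes W: "lin_subspace W1" "lin_subspace W2" "lin_subspace W3" "lin_subspace W4"
    and dim: "has_dim B W1 (N 0)" "has_dim B W2 (N 1)" "has_dim B W3 (N 2)" "has_dim B W4 (N 3)"
  defines "I \<equiv> Sigma {..<4::nat} (\<lambda>k. {..<N k})"
  obtains E :: "nat \<times> nat \<Rightarrow> 'n fields" where
    "\<And>k i. (k, i) \<in> I \<Longrightarrow> E (k, i) \<in> W1 \<times> W2 \<times> W3 \<times> W4 \<and> slot k (E (k, i))"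
    "\<And>c j. Z_null B (Z_sum I c E) \<Longrightarrow> j \<in> I \<Longrightarrow> c j = 0"
    "\<And>z. z \<in> W1 \<times> W2 \<times> W3 \<times> W4 \<Longrightarrow> \<exists>c. Z_lin B 1 (Z_sum I c E) 0 (Z_sum I c E) z"
proof -
  obtain e1 where e1: "\<And>i. i < N 0 \<Longrightarrow> e1 i \<in> W1"
      "\<And>c i. null_on B (\<lambda>x. \<Sum>i<N 0. c i *\<^sub>R e1 i x) \<Longrightarrow> i < N 0 \<Longrightarrow> c i = 0"
      "\<And>v. v \<in> W1 \<Longrightarrow> \<exists>c. null_on B (\<lambda>x. v x - (\<Sum>i<N 0. c i *\<^sub>R e1 i x))"
    using dim(1) unfolding has_dim_def by (elim exE conjE) (rule that, blast+)
  obtain e2 where e2: "\<And>i. i < N 1 \<Longrightarrow> e2 i \<in> W2"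
      "\<And>c i. null_on B (\<lambda>x. \<Sum>i<N 1. c i *\<^sub>R e2 i x) \<Longrightarrow> i < N 1 \<Longrightarrow> c i = 0"
      "\<And>v. v \<in> W2 \<Longrightarrow> \<exists>c. null_on B (\<lambda>x. v x - (\<Sum>i<N 1. c i *\<^sub>R e2 i x))"
    using dim(2) unfolding has_dim_def by (elim exE conjE) (rule that, blast+)
  obtain e3 where e3: "\<And>i. i < N 2 \<Longrightarrow> e3 i \<in> W3"
      "\<And>c i. null_on B (\<lambda>x. \<Sum>i<N 2. c i *\<^sub>R e3 i x) \<Longrightarrow> i < N 2 \<Longrightarrow> c i = 0"
      "\<And>v. v \<in> W3 \<Longrightarrow> \<exists>c. null_on B (\<lambda>x. v x - (\<Sum>i<N 2. c i *\<^sub>R e3 i x))"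
    using dim(3) unfolding has_dim_def by (elim exE conjE) (rule that, blast+)
  obtain e4 where e4: "\<And>i. i < N 3 \<Longrightarrow> e4 i \<in> W4"
      "\<And>c i. null_on B (\<lambda>x. \<Sum>i<N 3. c i *\<^sub>R e4 i x) \<Longrightarrow> i < N 3 \<Longrightarrow> c i = 0"
      "\<And>v. v \<in> W4 \<Longrightarrow> \<exists>c. null_on B (\<lambda>x. v x - (\<Sum>i<N 3. c i *\<^sub>R e4 i x))"
    using dim(4) unfolding has_dim_def by (elim exE conjE) (rule that, blast+)
  define E :: "nat \<times> nat \<Rightarrow> 'n fields" where
    "E = (\<lambda>(k, i). (if k = 0 then e1 i else (\<lambda>x. 0), if k = 1 then e2 i else (\<lambda>x. 0),
                    if k = 2 then e3 i else (\<lambda>x. 0), if k = 3 then e4 i else (\<lambda>x. 0)))"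
  have four: "{..<4::nat} = {0, 1, 2, 3}" by auto
  have sum_I: "(\<Sum>p\<in>I. f p) = (\<Sum>i<N 0. f (0, i)) + (\<Sum>i<N 1. f (1, i)) + (\<Sum>i<N 2. f (2, i)) + (\<Sum>i<N 3. f (3, i))"
    for f :: "nat \<times> nat \<Rightarrow> 'b::real_vector"
    unfolding I_def using sum.Sigma[of "{..<4::nat}" "\<lambda>k. {..<N k}" "\<lambda>k i. f (k, i)"]
    by (simp add: four add.assoc)
  have Z_sum: "Z_sum I c E = (\<lambda>x. \<Sum>i<N 0. c (0, i) *\<^sub>R e1 i x, \<lambda>x. \<Sum>i<N 1. c (1, i) *\<^sub>R e2 i x,
      \<lambda>x. \<Sum>i<N 2. c (2, i) *\<^sub>R e3 i x, \<lambda>x. \<Sum>i<N 3. c (3, i) *\<^sub>R e4 i x)" for c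
    unfolding Z_sum_def sum_I by (simp add: E_def)
  have zero: "(\<lambda>x. 0) \<in> W1" "(\<lambda>x. 0) \<in> W2" "(\<lambda>x. 0) \<in> W3" "(\<lambda>x. 0) \<in> W4"
    using W by (simp_all add: lin_subspace_def)
  show ?thesis
  proof (rule that[of E])
    show "E (k, i) \<in> W1 \<times> W2 \<times> W3 \<times> W4 \<and> slot k (E (k, i))" if "(k, i) \<in> I" for k i
      using that zero e1(1) e2(1) e3(1) e4(1) by (auto simp: E_def I_def four)
  next
    fix c j assume null: "Z_null B (Z_sum I c E)" and "j \<in> I"
    then obtain k i where j: "j = (k, i)" "k \<in> {0, 1, 2, 3}" "i < N k"
      unfolding I_def four by auto
    have "i < N 0 \<Longrightarrow> c (0, i) = 0" "i < N 1 \<Longrightarrow> c (1, i) = 0" "i < N 2 \<Longrightarrow> c (2, i) = 0" "i < N 3 \<Longrightarrow> c (3, i) = 0"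
      using null e1(2)[of "\<lambda>i. c (0, i)" i] e2(2)[of "\<lambda>i. c (1, i)" i] e3(2)[of "\<lambda>i. c (2, i)" i] e4(2)[of "\<lambda>i. c (3, i)" i]
      unfolding Z_sum Z_null.simps by blast+
    then show "c j = 0" using j by auto
  next
    fix z assume "z \<in> W1 \<times> W2 \<times> W3 \<times> W4"
    then obtain V M Q r where z: "z = (V, M, Q, r)" "V \<in> W1" "M \<in> W2" "Q \<in> W3" "r \<in> W4" by auto
    obtain c1 c2 c3 c4 where c: "null_on B (\<lambda>x. V x - (\<Sum>i<N 0. c1 i *\<^sub>R e1 i x))"
        "null_on B (\<lambda>x. M x - (\<Sum>i<N 1. c2 i *\<^sub>R e2 i x))"
        "null_on B (\<lambda>x. Q x - (\<Sum>i<N 2. c3 i *\<^sub>R e3 i x))"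
        "null_on B (\<lambda>x. r x - (\<Sum>i<N 3. c4 i *\<^sub>R e4 i x))"
      using e1(3)[OF z(2)] e2(3)[OF z(3)] e3(3)[OF z(4)] e4(3)[OF z(5)] by blast
    define c where "c = (\<lambda>(k :: nat, i). if k = 0 then c1 i else if k = 1 then c2 i else if k = 2 then c3 i else c4 i)"
    have "Z_lin B 1 (Z_sum I c E) 0 (Z_sum I c E) z"
      using c unfolding Z_sum z(1) by (simp add: ae_lin_def null_on_def c_def)
    then show "\<exists>c. Z_lin B 1 (Z_sum I c E) 0 (Z_sum I c E) z" by blast
  qed
qed

text \<open>Rows of the matrix are trial fields, columns are test fields. A dependence between
  columns is a test field annihilated by the trial basis, and expanding an arbitrary trial field
  extends this to all of \<open>Zh\<close>; dependent rows give the trial field. Independence modulo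
  null functions keeps both fields non-null.\<close>

lemma block_form_kernels:
  fixes b :: "'n::finite fields \<Rightarrow> 'n fields \<Rightarrow> real"
  assumes W: "lin_subspace W1" "lin_subspace W2" "lin_subspace W3" "lin_subspace W4"
    and dim: "has_dim B W1 (N 0)" "has_dim B W2 (N 1)" "has_dim B W3 (N 2)" "has_dim B W4 (N 3)"
    and Zh: "Zh = W1 \<times> W2 \<times> W3 \<times> W4"
    and left: "\<And>y. y \<in> Zh \<Longrightarrow> Z_linear_on B Zh (\<lambda>z. b z y)"
    and right: "\<And>z. z \<in> Zh \<Longrightarrow> Z_linear_on B Zh (b z)"
    and SJ: "S \<subseteq> {..<4}" "J \<subseteq> {..<4}" "sum N S < sum N J"
    and 0: "\<And>k l z y. k \<in> {..<4} - S \<Longrightarrow> l \<in> J \<Longrightarrow> z \<in> Zh \<Longrightarrow> y \<in> Zh \<Longrightarrow> slot k z \<Longrightarrow> slot l y \<Longrightarrow> b z y = 0"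
  shows "\<exists>y\<in>Zh. \<not> Z_null B y \<and> (\<forall>z\<in>Zh. b z y = 0)"
    and "\<exists>z\<in>Zh. \<not> Z_null B z \<and> (\<forall>y\<in>Zh. b z y = 0)"
proof -
  define I where "I = Sigma {..<4::nat} (\<lambda>k. {..<N k})"
  have I: "finite I" by (simp add: I_def)
  obtain E :: "nat \<times> nat \<Rightarrow> 'n fields" where
    E: "\<And>k i. (k, i) \<in> I \<Longrightarrow> E (k, i) \<in> Zh \<and> slot k (E (k, i))"
    and indep: "\<And>c j. Z_null B (Z_sum I c E) \<Longrightarrow> j \<in> I \<Longrightarrow> c j = 0"
    and span: "\<And>z. z \<in> Zh \<Longrightarrow> \<exists>c. Z_lin B 1 (Z_sum I c E) 0 (Z_sum I c E) z"
    by (rule product_basis[OF W dim, folded I_def Zh]) (rule that)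
  have EZ: "E p \<in> Zh" if "p \<in> I" for p
    using that E by (cases p) auto
  have mem: "Z_sum I c E \<in> Zh" for c
    unfolding Zh by (rule Z_sum_mem[OF W]) (use EZ Zh in blast)
  have lin: "L (Z_sum I c E) = (\<Sum>i\<in>I. c i * L (E i))" if "Z_linear_on B Zh L" for L c
    by (rule Z_linear_on_Z_sum[OF W that[unfolded Zh] I EZ[unfolded Zh]])
  have ex: "\<exists>c. L z = (\<Sum>i\<in>I. c i * L (E i))" if L: "Z_linear_on B Zh L" and z: "z \<in> Zh" for L z
  proof -
    obtain c where "Z_lin B 1 (Z_sum I c E) 0 (Z_sum I c E) z"
      using span[OF z] by (elim exE) (rule that)
    from Z_linear_onD[OF L mem mem z this] have "L z = (\<Sum>i\<in>I. c i * L (E i))" by (simp add: lin[OF L])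
    then show ?thesis by (intro exI[of _ c])
  qed
  define A where "A i j = b (E i) (E j)" for i j
  let ?T = "\<lambda>S. Sigma S (\<lambda>k. {..<N k})"
  have fin: "finite S" "finite J" using SJ finite_subset by blast+
  have sub: "?T S \<subseteq> I" "?T J \<subseteq> I" using SJ by (auto simp: I_def)
  have card: "card (?T S) < card (?T J)" using SJ(3) fin by simp
  have A0: "A i j = 0" if "i \<in> I - ?T S" "j \<in> ?T J" for i j
  proof -
    obtain k m where i: "i = (k, m)" by (cases i)
    obtain l n where j: "j = (l, n)" by (cases j)
    have "k \<in> {..<4} - S" "l \<in> J" "(k, m) \<in> I" "(l, n) \<in> I"
      using that SJ by (auto simp: i j I_def)
    then show ?thesis
      unfolding A_def i j using E[of k m] E[of l n] by (intro 0[of k l]) simp_all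
  qed
  have "\<exists>d. (\<exists>j\<in>I. d j \<noteq> 0) \<and> (\<forall>i\<in>I. (\<Sum>j\<in>I. A i j * d j) = 0)"
    by (rule zero_block_imp_kernels(1)[OF I sub card]) (rule A0)
  then obtain d where d: "\<exists>j\<in>I. d j \<noteq> 0" "\<forall>i\<in>I. (\<Sum>j\<in>I. A i j * d j) = 0"
    by (elim exE conjE) (rule that)
  have "\<exists>c. (\<exists>i\<in>I. c i \<noteq> 0) \<and> (\<forall>j\<in>I. (\<Sum>i\<in>I. c i * A i j) = 0)"
    by (rule zero_block_imp_kernels(2)[OF I sub card]) (rule A0)
  then obtain c where c: "\<exists>j\<in>I. c j \<noteq> 0" "\<forall>j\<in>I. (\<Sum>i\<in>I. c i * A i j) = 0"
    by (elim exE conjE) (rule that)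
  have "b z (Z_sum I d E) = 0" if z: "z \<in> Zh" for z
  proof -
    have "b (E i) (Z_sum I d E) = 0" if "i \<in> I" for i
      using lin[OF right[OF EZ[OF that]], of d] d(2) that by (simp add: A_def mult.commute)
    moreover obtain c where "b z (Z_sum I d E) = (\<Sum>i\<in>I. c i * b (E i) (Z_sum I d E))"
      using ex[OF left[OF mem[of d]] z] by (elim exE) (rule that)
    ultimately show ?thesis by simp
  qed
  moreover have "\<not> Z_null B (Z_sum I d E)" using indep[of d] d(1) by blast
  ultimately show "\<exists>y\<in>Zh. \<not> Z_null B y \<and> (\<forall>z\<in>Zh. b z y = 0)" using mem[of d] by blast
  have "b (Z_sum I c E) y = 0" if y: "y \<in> Zh" for y
  proof -
    have "b (Z_sum I c E) (E j) = 0" if "j \<in> I" for j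
      using lin[OF left[OF EZ[OF that]], of c] c(2) that by (simp add: A_def)
    moreover obtain d where "b (Z_sum I c E) y = (\<Sum>j\<in>I. d j * b (Z_sum I c E) (E j))"
      using ex[OF right[OF mem[of c]] y] by (elim exE) (rule that)
    ultimately show ?thesis by simp
  qed
  moreover have "\<not> Z_null B (Z_sum I c E)" using indep[of c] c(1) by blast
  ultimately show "\<exists>z\<in>Zh. \<not> Z_null B z \<and> (\<forall>y\<in>Zh. b z y = 0)" using mem[of c] by blast
qed

section \<open>Sparsity pattern of the linearized form\<close>

lemma ip_zero [simp]: "ip B (\<lambda>x. 0) g = 0" "ip B f (\<lambda>x. 0) = 0"
  by (simp_all add: ip_def)

text \<open>The gradient of the zero field is also a choice, so it vanishes only almost everywhere;
  the pairing does not see the difference.\<close>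

lemma ip_grad_zero:
  assumes "open B"
  shows "ip B (grad B (\<lambda>x. 0)) g = 0" "ip B g (grad B (\<lambda>x. 0)) = 0"
proof -
  have "(\<lambda>x. 0) \<in> vec_fields (H1 B)" by (simp add: vec_fields_def zero_in_H1)
  then have "AE x in lebesgue_on B. grad B (\<lambda>x. 0) x = 0"
    using grad_lin[OF assms, of 0 "\<lambda>x. 0" 0 "\<lambda>x. 0" "\<lambda>x. 0"] by (simp add: ae_lin_def)
  then have "AE x in lebesgue_on B. grad B (\<lambda>x. 0) x \<bullet> g x = 0" by eventually_elim simp
  then show "ip B (grad B (\<lambda>x. 0)) g = 0"
    unfolding ip_def by (rule integral_eq_zero_AE)
  then show "ip B g (grad B (\<lambda>x. 0)) = 0" by (simp add: ip_commute)
qed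

text \<open>The pairs (trial slot, test slot) in which the block matrix of the linearization may be nonzero.\<close>

definition coupled :: "nat \<Rightarrow> nat \<Rightarrow> bool" where
  "coupled k l \<longleftrightarrow> (k, l) \<in> {(2, 0), (0, 1), (1, 1), (1, 2), (2, 2), (3, 2), (1, 3)}"

lemma bform_uncoupled:
  assumes "open B" "slot k z" "slot l y" "\<not> coupled k l" "k < 4" "l < 4"
  shows "bform B \<P> w z y = 0"
proof -
  obtain U K P p where w: "w = (U, K, P, p)" by (cases w)
  obtain V M Q r where z: "z = (V, M, Q, r)" by (cases z)
  obtain \<Upsilon> \<Lambda> \<pi> q where y: "y = (\<Upsilon>, \<Lambda>, \<pi>, q)" by (cases y)
  have [simp]: "elast_app \<P> K 0 = 0" for K
    by (rule linear_0[OF linear_elast_app])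
  have [simp]: "X ** transpose 0 ** Y = 0" "trace (0 :: real^'a^'a) = 0" for X Y :: "real^'a^'a"
    using linear_0[OF linear_mult_transpose_mult[of 1 X Y]] by (simp_all add: trace_def)
  have "k \<in> {0, 1, 2, 3}" "l \<in> {0, 1, 2, 3}" using assms(5,6) by auto
  then show ?thesis
    using assms(2-4) unfolding w z y coupled_def
    by (elim insertE emptyE) (simp_all add: ip_grad_zero[OF assms(1)])
qed

lemma linearization_kernels:
  assumes B: "open B"
    and W: "lin_subspace W1" "lin_subspace W2" "lin_subspace W3" "lin_subspace W4"
    and H1: "W1 \<subseteq> vec_fields (H1 B)"
    and dim: "has_dim B W1 n1" "has_dim B W2 nc" "has_dim B W3 nd" "has_dim B W4 nD"
    and Zh: "Zh = W1 \<times> W2 \<times> W3 \<times> W4"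
    and ok: "\<And>z y. z \<in> Zh \<Longrightarrow> y \<in> Zh \<Longrightarrow> bform_ok B \<P> w z y"
    and n: "n1 > nd \<or> nD > nc \<or> n1 > nc \<or> nD > n1"
  shows "\<exists>y\<in>Zh. \<not> Z_null B y \<and> (\<forall>z\<in>Zh. bform B \<P> w z y = 0)"
    and "\<exists>z\<in>Zh. \<not> Z_null B z \<and> (\<forall>y\<in>Zh. bform B \<P> w z y = 0)"
proof -
  define N where "N = (\<lambda>k. [n1, nc, nd, nD] ! k)"
  have N: "N 0 = n1" "N 1 = nc" "N 2 = nd" "N 3 = nD" by (simp_all add: N_def)
  have four: "{..<4::nat} = {0, 1, 2, 3}" by auto
  \<comment> \<open>\<open>J\<close> is a set of test slots and \<open>S\<close> contains every
    trial slot coupled to one of them.\<close>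
  have "\<exists>S J. S \<subseteq> {..<4} \<and> J \<subseteq> {..<4} \<and> sum N S < sum N J \<and> (\<forall>k\<in>{..<4} - S. \<forall>l\<in>J. \<not> coupled k l)"
  proof -
    consider "n1 > nd" | "nD > nc" | "n1 > nc" | "nD > n1" using n by blast
    then show ?thesis
    proof cases
      case 1
      then show ?thesis
        by (intro exI[of _ "{2}"] exI[of _ "{0}"]) (simp add: four N coupled_def)
    next
      case 2
      then show ?thesis
        by (intro exI[of _ "{1}"] exI[of _ "{3}"]) (simp add: four N[simplified] coupled_def)
    next
      \<comment> \<open>That \<open>V\<close> meets \<open>\<Lambda>\<close> alone concerns a trial
        slot. Read from the test side: all slots except \<open>\<Lambda>\<close> miss
        \<open>V\<close>. The terms \<open>nd\<close> and \<open>nD\<close> cancel, leaving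
        \<open>nc < n1\<close>.\<close>
      case 3
      then show ?thesis
        by (intro exI[of _ "{1, 2, 3}"] exI[of _ "{0, 2, 3}"]) (simp add: four N[simplified] coupled_def)
    next
      \<comment> \<open>The common term \<open>nc\<close> cancels, leaving
        \<open>n1 < nD\<close>.\<close>
      case 4
      then show ?thesis
        by (intro exI[of _ "{0, 1}"] exI[of _ "{1, 3}"]) (simp add: four N[simplified] coupled_def)
    qed
  qed
  then obtain S J where SJ: "S \<subseteq> {..<4}" "J \<subseteq> {..<4}" "sum N S < sum N J"
    and unc: "\<And>k l. k \<in> {..<4} - S \<Longrightarrow> l \<in> J \<Longrightarrow> \<not> coupled k l" by blast
  have sub: "Zh \<subseteq> vec_fields (H1 B) \<times> UNIV" using H1 Zh by auto
  have left: "Z_linear_on B Zh (\<lambda>z. bform B \<P> w z y)" if "y \<in> Zh" for y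
    by (rule bform_linear_left[OF B sub ok[OF _ that]])
  have right: "Z_linear_on B Zh (bform B \<P> w z)" if "z \<in> Zh" for z
    by (rule bform_linear_right[OF B sub ok[OF that]])
  have 0: "bform B \<P> w z y = 0"
    if "k \<in> {..<4} - S" "l \<in> J" "slot k z" "slot l y" for k l z y
    using that(1,2) SJ(2) by (intro bform_uncoupled[OF B that(3,4) unc[OF that(1,2)]]) auto
  note kernels = block_form_kernels[OF W dim[folded N] Zh left right SJ 0]
  show "\<exists>y\<in>Zh. \<not> Z_null B y \<and> (\<forall>z\<in>Zh. bform B \<P> w z y = 0)" by (rule kernels(1))
  show "\<exists>z\<in>Zh. \<not> Z_null B z \<and> (\<forall>y\<in>Zh. bform B \<P> w z y = 0)" by (rule kernels(2))
qed

section \<open>Consequences for the inf-sup condition and the Newton step\<close>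

lemma inf_sup_le_0:
  assumes "y \<in> Zh" "\<not> Z_null B y" "\<And>z. z \<in> Zh \<Longrightarrow> bform B \<P> w z y = 0"
  shows "inf_sup B \<P> w Zh \<le> 0"
  unfolding inf_sup_def
  \<comment> \<open>At this test field every quotient is 0, whatever the norms are, so the supremum
    is at most 0.\<close>
  by (rule INF_lower2[of y]) (use assms in \<open>auto intro!: SUP_least simp: zero_ereal_def\<close>)

lemma not_newton_uniquely_solvable:
  assumes W: "lin_subspace W1" "lin_subspace W2" "lin_subspace W3" "lin_subspace W4"
    and Zh: "Zh = W1 \<times> W2 \<times> W3 \<times> W4"
    and left: "\<And>y. y \<in> Zh \<Longrightarrow> Z_linear_on B Zh (\<lambda>z. bform B \<P> w z y)"
    and z0: "z0 \<in> Zh" "\<not> Z_null B z0" "\<And>y. y \<in> Zh \<Longrightarrow> bform B \<P> w z0 y = 0"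
  shows "\<not> newton_uniquely_solvable B \<Gamma>2 \<P> F T w Zh"
proof
  assume "newton_uniquely_solvable B \<Gamma>2 \<P> F T w Zh"
  then obtain z where z: "newton_step B \<Gamma>2 \<P> F T w Zh z"
    and uniq: "\<And>z'. newton_step B \<Gamma>2 \<P> F T w Zh z' \<Longrightarrow> Z_null B (Z_diff z' z)"
    unfolding newton_uniquely_solvable_def by blast
  have zZ: "z \<in> Zh" using z by (simp add: newton_step_def)
  obtain V M Q r where zz: "z = (V, M, Q, r)" by (cases z)
  obtain V0 M0 Q0 r0 where zz0: "z0 = (V0, M0, Q0, r0)" by (cases z0)
  define z' where "z' = (\<lambda>x. V x + V0 x, \<lambda>x. M x + M0 x, \<lambda>x. Q x + Q0 x, \<lambda>x. r x + r0 x)"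
  have z': "z' \<in> Zh"
    using zZ z0(1) W unfolding Zh zz zz0 z'_def lin_subspace_def by simp
  have "Z_lin B 1 z 1 z0 z'" by (simp add: zz zz0 z'_def ae_lin_def)
  then have "bform B \<P> w z' y = bform B \<P> w z y" if "y \<in> Zh" for y
    using Z_linear_onD[OF left[OF that] zZ z0(1) z'] z0(3)[OF that] by fastforce
  then have "newton_step B \<Gamma>2 \<P> F T w Zh z'"
    using z z' by (simp add: newton_step_def)
  then have "Z_null B (Z_diff z' z)" by (rule uniq)
  then show False using z0(2) by (simp add: z'_def zz zz0)
qed

theorem theorem1:
  fixes B \<Gamma>1 \<Gamma>2 :: "'n::{finite,linorder} region"
    and \<P> :: "'n tensor_map"
    and F Ubar Tbar :: "'n vfield"
    and V1 :: "'n sfield set" and Vc Vd :: "'n tfield set" and VD :: "'n sfield set"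
    and V1n V1n_van :: "'n vfield set"
    and Zbar_h Z_h :: "'n fields set"
    and u u_hi :: "'n fields"
    and n1 nc nd nD :: nat
  defines "V1n \<equiv> vec_fields V1"
    and "V1n_van \<equiv> V1n \<inter> vec_fields (H1_van B \<Gamma>1)"
    and "Zbar_h \<equiv> V1n \<times> Vc \<times> Vd \<times> VD"
    and "Z_h \<equiv> V1n_van \<times> Vc \<times> Vd \<times> VD"
  assumes "CARD('n) \<in> {2, 3}"
    and "open B" and "frontier B = \<Gamma>1 \<union> \<Gamma>2"
    and "\<forall>K. \<P> differentiable (at K)"
    and "fin_dim_subspace B V1 (H1 B)"
    and "fin_dim_subspace B Vc (Hcurl B)"
    and "fin_dim_subspace B Vd (Hdiv B)"
    and "fin_dim_subspace B VD (L2 B)"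
    and "has_dim B V1n_van n1" and "has_dim B Vc nc" and "has_dim B Vd nd" and "has_dim B VD nD"
    and "regular_solution B \<Gamma>1 \<Gamma>2 \<P> F Ubar Tbar u"
    and "ae_invertible B u"
    and "u_hi \<in> Zbar_h"
    and "ae_invertible B u_hi"
    and "\<forall>y\<in>Z_h. Hform_ok B \<Gamma>2 \<P> F Tbar u_hi y"
    and "\<forall>z\<in>Z_h. \<forall>y\<in>Z_h. bform_ok B \<P> u_hi z y"
    and "n1 > nd \<or> nD > nc \<or> n1 > nc + nD \<or> nD > n1"
  shows "\<not> (\<exists>\<alpha>>0. inf_sup B \<P> u Z_h \<ge> ereal \<alpha>) \<and>
         \<not> newton_uniquely_solvable B \<Gamma>2 \<P> F Tbar u_hi Z_h"
proof -
  note B = \<open>open B\<close>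
  note dims = \<open>has_dim B V1n_van n1\<close> \<open>has_dim B Vc nc\<close> \<open>has_dim B Vd nd\<close> \<open>has_dim B VD nD\<close>
  note spaces = \<open>fin_dim_subspace B V1 (H1 B)\<close> \<open>fin_dim_subspace B Vc (Hcurl B)\<close>
    \<open>fin_dim_subspace B Vd (Hdiv B)\<close> \<open>fin_dim_subspace B VD (L2 B)\<close>
  have Zh: "Z_h = V1n_van \<times> Vc \<times> Vd \<times> VD" by (simp add: Z_h_def)
  have W: "lin_subspace V1n_van" "lin_subspace Vc" "lin_subspace Vd" "lin_subspace VD"
    using spaces lin_subspace_H1_van[OF B]
    by (auto simp: fin_dim_subspace_def V1n_van_def V1n_def intro!: lin_subspace_Int lin_subspace_vec_fields)
  have H1: "V1n_van \<subseteq> vec_fields (H1 B)"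
    by (auto simp: V1n_van_def vec_fields_def H1_van_def)
  \<comment> \<open>Conformity: the finiteness of the integrals at \<open>u\<close>, part of
    \<open>nonsingular\<close> on the full space, restricts to the discrete fields.\<close>
  have "Z_h \<subseteq> Zspace B \<Gamma>1"
    using spaces by (auto simp: Zh Zspace_def V1n_van_def fin_dim_subspace_def)
  then have ok: "bform_ok B \<P> u z y" if "z \<in> Z_h" "y \<in> Z_h" for z y
    using that \<open>regular_solution B \<Gamma>1 \<Gamma>2 \<P> F Ubar Tbar u\<close>
    unfolding regular_solution_def nonsingular_def by blast
  have ok_hi: "bform_ok B \<P> u_hi z y" if "z \<in> Z_h" "y \<in> Z_h" for z y
    using that \<open>\<forall>z\<in>Z_h. \<forall>y\<in>Z_h. bform_ok B \<P> u_hi z y\<close> by blast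
  have n: "n1 > nd \<or> nD > nc \<or> n1 > nc \<or> nD > n1"
    using \<open>n1 > nd \<or> nD > nc \<or> n1 > nc + nD \<or> nD > n1\<close> by linarith
  obtain y where "y \<in> Z_h" "\<not> Z_null B y" "\<forall>z\<in>Z_h. bform B \<P> u z y = 0"
    using linearization_kernels(1)[OF B W H1 dims Zh ok n] by blast
  then have "inf_sup B \<P> u Z_h \<le> 0" by (intro inf_sup_le_0) auto
  then have "\<not> (\<exists>\<alpha>>0. inf_sup B \<P> u Z_h \<ge> ereal \<alpha>)"
    by (metis ereal_less(2) leD order_trans)
  moreover have "\<not> newton_uniquely_solvable B \<Gamma>2 \<P> F Tbar u_hi Z_h"
  proof -
    obtain z0 where z0: "z0 \<in> Z_h" "\<not> Z_null B z0" "\<forall>y\<in>Z_h. bform B \<P> u_hi z0 y = 0"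
      using linearization_kernels(2)[OF B W H1 dims Zh ok_hi n] by blast
    have "Z_h \<subseteq> vec_fields (H1 B) \<times> UNIV" using H1 Zh by auto
    then have "Z_linear_on B Z_h (\<lambda>z. bform B \<P> u_hi z y)" if "y \<in> Z_h" for y
      by (rule bform_linear_left[OF B _ ok_hi[OF _ that]])
    then show ?thesis
      by (rule not_newton_uniquely_solvable[OF W Zh _ z0(1,2)]) (use z0(3) in auto)
  qed
  ultimately show ?thesis by blast
qed

end
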